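(* Let $\mathcal H$ be a Hopf algebra and $\Lambda\in\mathcal H$ an element of integral type. Then: (1) if $\mathcal A_\Lambda$ is unimodular and admits a faithful $1$-cointegral, then $S(\Lambda)=\Lambda$ and $S^2(\mathcal A_\Lambda)=\mathcal A_\Lambda$; (2) if $\Lambda^2=\Lambda$ and $\mathcal A_\Lambda$ admits a faithful $1$-cointegral, then $\mathcal A_\Lambda$ is unimodular, $S^2(\mathcal A_\Lambda)=\mathcal A_\Lambda$, $\Lambda$ is a two-sided group-like projection, and $\mathcal A_\Lambda$ is semisimple; (3) if $\mathcal A$ is a semisimple left coideal subalgebra of $\mathcal H$ with $S^2(\mathcal A)=\mathcal A$, then $\mathcal A$ admits a faithful $1$-cointegral, unique up to a multiplicative constant.
   Context: $k$ is a field; $\mathcal H$ is a Hopf algebra over $k$ with comultiplication $\Delta$, counit $\varepsilon$, invertible antipode $S$. A left coideal subalgebra is a subalgebra $\mathcal A\ni1$ with $\Delta(\mathcal A)\subset\mathcal H\otimes\mathcal A$. A non-zero $\Lambda$ is of integral type if $\Delta(\Lambda)(1\otimes\Lambda)=\Lambda\otimes\Lambda$; $\mathcal A_\Lambda=\{a\in\mathcal H:\Delta(a)(1\otimes\Lambda)=b\otimes\Lambda\text{ for some }b\in\mathcal H\}$. $L^{\mathcal A}_\varepsilon=\{x\in\mathcal A: ax=\varepsilon(a)x\ \forall a\}$, $R^{\mathcal A}_\varepsilon=\{x\in\mathcal A: xa=\varepsilon(a)x\ \forall a\}$, and $\mathcal A$ is unimodular if they coincide. A $1$-cointegral on $\mathcal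 A$ is $\phi\in\mathcal A'$ with $(\mathrm{id}\otimes\phi)(\Delta(a))=\phi(a)1$ for all $a\in\mathcal A$; it is faithful if $\phi(ab)=0$ for all $b$ implies $a=0$. A non-zero idempotent $P$ is a two-sided group-like projection if $\Delta(P)(1\otimes P)=(1\otimes P)\Delta(P)=P\otimes P$ and $\Delta(P)(P\otimes1)=(P\otimes1)\Delta(P)=P\otimes P$. *)

theory Defs
  imports Main "HOL.Vector_Spaces"
begin

text \<open>
  Conventions.  A k-algebra H is a type 'h of class ring_1 together with a scalar
  multiplication scale over a field 'k.  An element of H (x) H is represented
  concretely by a finite list of pairs [(x1,y1),...,(xn,yn)] standing for
  x1 (x) y1 + ... + xn (x) yn.  Two such lists denote the same element of the
  algebraic tensor product iff they agree under all f (x) g for linear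
  functionals f, g (this map is injective over a field); this is teq.
\<close>

definition lin_fun :: "('k::field \<Rightarrow> 'h::ring_1 \<Rightarrow> 'h) \<Rightarrow> ('h \<Rightarrow> 'k) \<Rightarrow> bool" where
  "lin_fun scale f \<longleftrightarrow> (\<forall>a b. f (a + b) = f a + f b) \<and> (\<forall>c a. f (scale c a) = c * f a)"

definition lin_map :: "('k::field \<Rightarrow> 'h::ring_1 \<Rightarrow> 'h) \<Rightarrow> ('h \<Rightarrow> 'h) \<Rightarrow> bool" where
  "lin_map scale F \<longleftrightarrow> (\<forall>a b. F (a + b) = F a + F b) \<and> (\<forall>c a. F (scale c a) = scale c (F a))"

definition teval :: "('h \<Rightarrow> 'k::field) \<Rightarrow> ('h \<Rightarrow> 'k) \<Rightarrow> ('h \<times> 'h) list \<Rightarrow> 'k" where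
  "teval f g t = (\<Sum>(x, y)\<leftarrow>t. f x * g y)"

definition teq :: "('k::field \<Rightarrow> 'h::ring_1 \<Rightarrow> 'h) \<Rightarrow> ('h \<times> 'h) list \<Rightarrow> ('h \<times> 'h) list \<Rightarrow> bool" where
  "teq scale t u \<longleftrightarrow> (\<forall>f g. lin_fun scale f \<longrightarrow> lin_fun scale g \<longrightarrow> teval f g t = teval f g u)"

definition tmult :: "('h::ring_1 \<times> 'h) list \<Rightarrow> ('h \<times> 'h) list \<Rightarrow> ('h \<times> 'h) list" where
  "tmult t u = concat (map (\<lambda>(x, y). map (\<lambda>(x', y'). (x * x', y * y')) u) t)"

locale hopf_algebra = vector_space scale
  for scale :: "'k::field \<Rightarrow> 'h::ring_1 \<Rightarrow> 'h" +
  fixes comult :: "'h \<Rightarrow> ('h \<times> 'h) list"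
    and counit :: "'h \<Rightarrow> 'k"
    and S :: "'h \<Rightarrow> 'h"
  assumes scale_mult_left: "scale c (a * b) = scale c a * b"
    and scale_mult_right: "scale c (a * b) = a * scale c b"
    and comult_add: "teq scale (comult (a + b)) (comult a @ comult b)"
    and comult_scale: "teq scale (comult (scale c a)) (map (\<lambda>(x, y). (scale c x, y)) (comult a))"
    and comult_one: "teq scale (comult 1) [(1, 1)]"
    and comult_mult: "teq scale (comult (a * b)) (tmult (comult a) (comult b))"
    and counit_lin: "lin_fun scale counit"
    and counit_one: "counit 1 = 1"
    and counit_mult: "counit (a * b) = counit a * counit b"
    and coassoc: "lin_fun scale f \<Longrightarrow> lin_fun scale g \<Longrightarrow> lin_fun scale h \<Longrightarrow>
        (\<Sum>(x, y)\<leftarrow>comult a. (\<Sum>(u, v)\<leftarrow>comult x. f u * g v) * h y)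
      = (\<Sum>(x, y)\<leftarrow>comult a. f x * (\<Sum>(u, v)\<leftarrow>comult y. g u * h v))"
    and counit_left: "(\<Sum>(x, y)\<leftarrow>comult a. scale (counit x) y) = a"
    and counit_right: "(\<Sum>(x, y)\<leftarrow>comult a. scale (counit y) x) = a"
    and antipode_lin: "lin_map scale S"
    and antipode_left: "(\<Sum>(x, y)\<leftarrow>comult a. S x * y) = scale (counit a) 1"
    and antipode_right: "(\<Sum>(x, y)\<leftarrow>comult a. x * S y) = scale (counit a) 1"
    and antipode_bij: "bij S"

definition integral_type where
  "integral_type scale comult L \<longleftrightarrow> L \<noteq> 0 \<and>
     teq scale (map (\<lambda>(x, y). (x, y * L)) (comult L)) [(L, L)]"

definition A_of where
  "A_of scale comult L = {a. \<exists>b. teq scale (map (\<lambda>(x, y). (x, y * L)) (comult a)) [(b, L)]}"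

definition subalg :: "('k::field \<Rightarrow> 'h::ring_1 \<Rightarrow> 'h) \<Rightarrow> 'h set \<Rightarrow> bool" where
  "subalg scale A \<longleftrightarrow> 1 \<in> A \<and> (\<forall>a\<in>A. \<forall>b\<in>A. a + b \<in> A \<and> a * b \<in> A) \<and>
     (\<forall>c. \<forall>a\<in>A. scale c a \<in> A)"

text \<open>\<Delta>(A) \<subseteq> H (x) A: each \<Delta>(a) has a representative with right legs in A.\<close>
definition left_coideal_subalg where
  "left_coideal_subalg scale comult A \<longleftrightarrow> subalg scale A \<and>
     (\<forall>a\<in>A. \<exists>t. teq scale t (comult a) \<and> (\<forall>(x, y)\<in>set t. y \<in> A))"

definition L_eps where
  "L_eps scale counit A = {x\<in>A. \<forall>a\<in>A. a * x = scale (counit a) x}"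

definition R_eps where
  "R_eps scale counit A = {x\<in>A. \<forall>a\<in>A. x * a = scale (counit a) x}"

definition unimodular where
  "unimodular scale counit A \<longleftrightarrow> L_eps scale counit A = R_eps scale counit A"

definition lin_fun_on :: "('k::field \<Rightarrow> 'h::ring_1 \<Rightarrow> 'h) \<Rightarrow> 'h set \<Rightarrow> ('h \<Rightarrow> 'k) \<Rightarrow> bool" where
  "lin_fun_on scale A phi \<longleftrightarrow> (\<forall>a\<in>A. \<forall>b\<in>A. phi (a + b) = phi a + phi b) \<and>
     (\<forall>c. \<forall>a\<in>A. phi (scale c a) = c * phi a)"

text \<open>1-cointegral on A: (id (x) \<phi>)(\<Delta>(a)) = \<phi>(a) 1, evaluated on any representative
  of \<Delta>(a) in H (x) A (well defined since \<phi> is linear on A).\<close>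
definition one_cointegral where
  "one_cointegral scale comult A phi \<longleftrightarrow> lin_fun_on scale A phi \<and>
     (\<forall>a\<in>A. \<forall>t. teq scale t (comult a) \<and> (\<forall>(x, y)\<in>set t. y \<in> A) \<longrightarrow>
        (\<Sum>(x, y)\<leftarrow>t. scale (phi y) x) = scale (phi a) 1)"

definition faithful_on where
  "faithful_on A phi \<longleftrightarrow> (\<forall>a\<in>A. (\<forall>b\<in>A. phi (a * b) = 0) \<longrightarrow> a = 0)"

definition faithful_one_cointegral where
  "faithful_one_cointegral scale comult A phi \<longleftrightarrow>
     one_cointegral scale comult A phi \<and> faithful_on A phi"

definition two_sided_glp where
  "two_sided_glp scale comult P \<longleftrightarrow> P \<noteq> 0 \<and> P * P = P \<and>
     teq scale (map (\<lambda>(x, y). (x, y * P)) (comult P)) [(P, P)] \<and>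
     teq scale (map (\<lambda>(x, y). (x, P * y)) (comult P)) [(P, P)] \<and>
     teq scale (map (\<lambda>(x, y). (x * P, y)) (comult P)) [(P, P)] \<and>
     teq scale (map (\<lambda>(x, y). (P * x, y)) (comult P)) [(P, P)]"

definition left_ideal_in :: "'h::ring_1 set \<Rightarrow> 'h set \<Rightarrow> bool" where
  "left_ideal_in A I \<longleftrightarrow> I \<subseteq> A \<and> 0 \<in> I \<and> (\<forall>x\<in>I. \<forall>y\<in>I. x + y \<in> I) \<and>
     (\<forall>x\<in>I. - x \<in> I) \<and> (\<forall>a\<in>A. \<forall>x\<in>I. a * x \<in> I)"

definition semisimple_alg :: "'h::ring_1 set \<Rightarrow> bool" where
  "semisimple_alg A \<longleftrightarrow> (\<forall>I. left_ideal_in A I \<longrightarrow>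
     (\<exists>J. left_ideal_in A J \<and> I \<inter> J = {0} \<and> A = {x + y |x y. x \<in> I \<and> y \<in> J}))"

end

theory Submission
  imports Defs
begin

text \<open>
  Write \<open>\<Delta>(L) = L\<^sub>1 \<otimes> L\<^sub>2\<close>. The cancellation law \<open>c\<^sub>1 \<otimes> c\<^sub>2 L = 0 \<Longrightarrow> c = 0\<close> shows that \<open>A\<^sub>L\<close> is a left
  coideal subalgebra and \<open>L\<close> a left integral in it. For every left integral in a left coideal
  subalgebra \<open>L\<^sub>1 \<otimes> a L\<^sub>2 = S(a) L\<^sub>1 \<otimes> L\<^sub>2\<close>, so a cointegral \<open>\<phi>\<close> satisfies
  \<open>\<phi>(L) S(a) = \<phi>(a L\<^sub>2) L\<^sub>1\<close>. If \<open>\<phi>(L) \<noteq> 0\<close>, then in a minimal representation of \<open>\<Delta>(L)\<close> both the right legs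
  and the images of the left legs under \<open>S\<^sup>-\<^sup>1\<close> are bases of \<open>A\<close>. If \<open>L\<close> is also a right integral, taking
  \<open>a = L\<close> gives \<open>S(L) = L\<close>, and comparing legs of \<open>\<Delta>(L) = S(L\<^sub>2) \<otimes> S(L\<^sub>1)\<close> gives \<open>S\<^sup>2(A) = A\<close>.
  If \<open>L\<close> is idempotent, \<open>A\<close> is finite-dimensional, so faithfulness of \<open>\<phi>\<close> yields a right
  integral, which must be a multiple of \<open>L\<close>; semisimplicity follows because
  \<open>L\<^sub>2 \<otimes> S\<^sup>-\<^sup>1(L\<^sub>1)\<close> is a separability idempotent.
  Conversely, a semisimple \<open>A\<close> has a two-sided integral \<open>L\<close> with \<open>\<epsilon>(L) = 1\<close>, and the trace
  of \<open>x \<mapsto> a S\<^sup>2(x)\<close> is a cointegral with value 1 at \<open>L\<close>.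
\<close>

section \<open>Linear algebra\<close>

context vector_space
begin

text \<open>Independence of an indexed family, not of a set: a repeated vector counts as dependent.
  This suits tensors written as sums over one index set.\<close>

definition indep_family :: "'i set \<Rightarrow> ('i \<Rightarrow> 'b) \<Rightarrow> bool" where
  "indep_family I x \<longleftrightarrow> finite I \<and> (\<forall>c. (\<Sum>i\<in>I. c i *s x i) = 0 \<longrightarrow> (\<forall>i\<in>I. c i = 0))"

lemma indep_familyD:
  "indep_family I x \<Longrightarrow> (\<Sum>i\<in>I. c i *s x i) = 0 \<Longrightarrow> i \<in> I \<Longrightarrow> c i = 0"
  by (auto simp: indep_family_def)

lemma indep_family_inj_on:
  assumes "indep_family I x" shows "inj_on x I"
proof (rule inj_onI, rule ccontr)
  fix i j assume ij: "i \<in> I" "j \<in> I" "x i = x j" "i \<noteq> j"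
  have fin: "finite I" using assms by (simp add: indep_family_def)
  let ?c = "\<lambda>k. if k = i then 1 else if k = j then - 1 else 0"
  have "(\<Sum>k\<in>I. ?c k *s x k) = (\<Sum>k\<in>{i,j}. ?c k *s x k)"
    using ij fin by (intro sum.mono_neutral_right) auto
  also have "\<dots> = 0" using ij by simp
  finally show False using indep_familyD[OF assms, of ?c i] ij(1) by simp
qed

lemma indep_family_independent:
  assumes "indep_family I x" shows "independent (x ` I)"
proof -
  have fin: "finite I" using assms by (simp add: indep_family_def)
  have "u v = 0" if "(\<Sum>v\<in>x ` I. u v *s v) = 0" "v \<in> x ` I" for u v
  proof -
    have "(\<Sum>i\<in>I. u (x i) *s x i) = 0"
      using that(1) by (simp add: sum.reindex[OF indep_family_inj_on[OF assms]])
    then show ?thesis using assms that(2) by (auto dest: indep_familyD)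
  qed
  then show ?thesis using fin by (auto simp: dependent_finite)
qed

lemma independent_imp_indep_family:
  assumes "finite B" "independent B" shows "indep_family B (\<lambda>b. b)"
  using assms by (auto simp: indep_family_def dependent_finite)

lemma span_image_family:
  assumes "finite I" "y \<in> span (x ` I)"
  obtains c where "y = (\<Sum>i\<in>I. c i *s x i)"
proof -
  have "\<exists>c. y = (\<Sum>i\<in>I. c i *s x i)"
    using assms(2)
  proof (induction rule: span_induct_alt)
    case base
    show ?case by (rule exI[of _ "\<lambda>_. 0"]) simp
  next
    case (step r z y)
    then obtain c j where c: "y = (\<Sum>i\<in>I. c i *s x i)" and j: "j \<in> I" "z = x j" by auto
    have "r *s z + y = (\<Sum>i\<in>I. (c i + (if i = j then r else 0)) *s x i)"
      using j assms(1)
      by (simp add: c scale_left_distrib sum.distrib if_distrib[of "\<lambda>r. r *s _"] cong: if_cong)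
    then show ?case by (rule exI[where x = "\<lambda>i. c i + (if i = j then r else 0)"])
  qed
  then show ?thesis using that by blast
qed

text \<open>Exchange argument: if some \<open>w i\<close> lay outside the span of \<open>v\<close>,
  adjoining it would give \<open>card I + 1\<close> independent vectors in a space spanned by at
  most \<open>card I\<close>. The common index set makes the count work.\<close>

lemma indep_family_spans:
  assumes v: "indep_family I v" and A: "subspace A" and vA: "\<And>i. i \<in> I \<Longrightarrow> v i \<in> A"
    and Aw: "A \<subseteq> span (w ` I)"
  shows "span (v ` I) = A" "span (w ` I) = A"
proof -
  have fin: "finite I" using v by (simp add: indep_family_def)
  have sub: "span (v ` I) \<subseteq> A" using A vA by (intro span_minimal) auto
  have sup: "span (w ` I) \<subseteq> span (v ` I)"
  proof (rule ccontr)
    assume "\<not> ?thesis"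
    then obtain i where i: "i \<in> I" "w i \<notin> span (v ` I)"
      by (meson image_subsetI span_mono span_span subspace_span span_minimal)
    have "independent (insert (w i) (v ` I))"
      using i indep_family_independent[OF v] by (simp add: independent_insert)
    moreover have "insert (w i) (v ` I) \<subseteq> span (w ` I)"
      using i vA Aw by (auto intro: span_base)
    ultimately have "card (insert (w i) (v ` I)) \<le> card (w ` I)"
      using independent_span_bound[of "w ` I"] fin by auto
    moreover have "card (insert (w i) (v ` I)) = Suc (card I)"
      using i fin indep_family_inj_on[OF v] by (subst card_insert_disjoint) (auto simp: card_image intro: span_base)
    moreover have "card (w ` I) \<le> card I" using fin by (rule card_image_le)
    ultimately show False by simp
  qed
  show "span (v ` I) = A" "span (w ` I) = A" using sub sup Aw by auto
qed

end

section \<open>Sums over lists of pairs\<close>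

lemma sum_list_sum_swap:
  "(\<Sum>(x, y)\<leftarrow>t. \<Sum>b\<in>C. F b x y) = (\<Sum>b\<in>C. \<Sum>(x, y)\<leftarrow>t. (F b x y :: 'c::comm_monoid_add))"
  by (induction t) (auto simp: sum.distrib)

lemma sum_list_pair_mult_left:
  "(\<Sum>(x, y)\<leftarrow>t. c * F x y) = c * (\<Sum>(x, y)\<leftarrow>t. (F x y :: 'c::semiring_0))"
  by (induction t) (auto simp: distrib_left)

lemma sum_list_pair_mult_right:
  "(\<Sum>(x, y)\<leftarrow>t. F x y * c) = (\<Sum>(x, y)\<leftarrow>t. (F x y :: 'c::semiring_0)) * c"
  by (induction t) (auto simp: distrib_right)

lemma sum_list_pair_cong:
  "(\<And>x y. (x, y) \<in> set t \<Longrightarrow> F x y = G x y) \<Longrightarrow> (\<Sum>(x, y)\<leftarrow>t. F x y) = (\<Sum>(x, y)\<leftarrow>t. G x y)"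
  by (rule arg_cong[of _ _ sum_list], rule map_cong) auto

lemma sum_list_pair_add:
  "(\<Sum>(x, y)\<leftarrow>t. F x y + G x y) = (\<Sum>(x, y)\<leftarrow>t. F x y) + (\<Sum>(x, y)\<leftarrow>t. (G x y :: 'c::comm_monoid_add))"
  by (induction t) (auto simp: algebra_simps)

lemma sum_list_pair_swap:
  "(\<Sum>(x, y)\<leftarrow>t. \<Sum>(u, v)\<leftarrow>s. F x y u v) = (\<Sum>(u, v)\<leftarrow>s. \<Sum>(x, y)\<leftarrow>t. (F x y u v :: 'c::comm_monoid_add))"
proof (induction t)
  case Nil
  show ?case by (induction s) auto
next
  case (Cons p t)
  then show ?case by (cases p) (simp add: sum_list_pair_add)
qed

context hopf_algebra
begin

section \<open>Linear functionals, dual families and coordinates\<close>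

abbreviation lf :: "('h \<Rightarrow> 'k) \<Rightarrow> bool" where "lf \<equiv> lin_fun scale"
abbreviation lm :: "('h \<Rightarrow> 'h) \<Rightarrow> bool" where "lm \<equiv> lin_map scale"

lemma lf_add: "lf f \<Longrightarrow> f (a + b) = f a + f b"
  and lf_scale: "lf f \<Longrightarrow> f (scale c a) = c * f a"
  by (auto simp: lin_fun_def)

lemma lf_zero: "lf f \<Longrightarrow> f 0 = 0"
  using lf_scale[of f 0 0] by simp

lemma lf_minus: "lf f \<Longrightarrow> f (- a) = - f a"
  using lf_add[of f a "- a"] by (simp add: lf_zero minus_unique)

lemma lf_diff: "lf f \<Longrightarrow> f (a - b) = f a - f b"
  using lf_add[of f a "- b"] by (simp add: lf_minus)

lemma lf_sum: "lf f \<Longrightarrow> f (\<Sum>i\<in>I. x i) = (\<Sum>i\<in>I. f (x i))"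
  by (induction I rule: infinite_finite_induct) (auto simp: lf_zero lf_add)

lemma lf_sum_list: "lf f \<Longrightarrow> f (\<Sum>(x, y)\<leftarrow>t. F x y) = (\<Sum>(x, y)\<leftarrow>t. f (F x y))"
  by (induction t) (auto simp: lf_zero lf_add)

lemma lm_add: "lm g \<Longrightarrow> g (a + b) = g a + g b"
  and lm_scale: "lm g \<Longrightarrow> g (scale c a) = scale c (g a)"
  by (auto simp: lin_map_def)

lemma lm_zero: "lm g \<Longrightarrow> g 0 = 0"
  using lm_scale[of g 0 0] by simp

lemma lm_diff: "lm g \<Longrightarrow> g (a - b) = g a - g b"
  using lm_add[of g "a - b" b] by simp

lemma lm_sum: "lm g \<Longrightarrow> g (\<Sum>i\<in>I. x i) = (\<Sum>i\<in>I. g (x i))"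
  by (induction I rule: infinite_finite_induct) (auto simp: lm_zero lm_add)

lemma vector_space_pair_field: "vector_space_pair scale ((*) :: 'k \<Rightarrow> 'k \<Rightarrow> 'k)"
  by unfold_locales (auto simp: algebra_simps)

lemma linear_imp_lf: "Vector_Spaces.linear scale ((*) :: 'k \<Rightarrow> 'k \<Rightarrow> 'k) f \<Longrightarrow> lf f"
  by (simp add: linear_iff lin_fun_def)

lemma lf_independent_extend:
  assumes "independent B" obtains g where "lf g" "\<And>b. b \<in> B \<Longrightarrow> g b = f b"
  using vector_space_pair.linear_independent_extend[OF vector_space_pair_field assms, of f] linear_imp_lf
  by blast

lemma dual_family:
  assumes "indep_family I x"
  obtains f where "\<And>i. lf (f i)" "\<And>i j. i \<in> I \<Longrightarrow> j \<in> I \<Longrightarrow> f i (x j) = (if i = j then 1 else 0)"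
proof -
  have "\<exists>g. lf g \<and> (\<forall>b\<in>x ` I. g b = (if i \<in> I \<and> b = x i then 1 else 0))" for i
    using lf_independent_extend[OF indep_family_independent[OF assms], of "\<lambda>b. if i \<in> I \<and> b = x i then 1 else 0"]
    by metis
  then obtain f where f: "\<And>i. lf (f i)" "\<And>i b. b \<in> x ` I \<Longrightarrow> f i b = (if i \<in> I \<and> b = x i then 1 else 0)"
    by metis
  show ?thesis
  proof (rule that[of f])
    show "f i (x j) = (if i = j then 1 else 0)" if "i \<in> I" "j \<in> I" for i j
      using f(2)[of "x j" i] that inj_onD[OF indep_family_inj_on[OF assms], of i j] by auto
  qed (use f in auto)
qed

lemma dual_family_expand:
  assumes "finite I" and f: "\<And>i. lf (f i)"
    and d: "\<And>i j. i \<in> I \<Longrightarrow> j \<in> I \<Longrightarrow> f i (x j) = (if i = j then 1 else 0)"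
    and y: "y \<in> span (x ` I)"
  shows "y = (\<Sum>i\<in>I. scale (f i y) (x i))"
proof -
  obtain c where c: "y = (\<Sum>i\<in>I. scale (c i) (x i))" using span_image_family[OF assms(1) y] .
  have "f i y = c i" if "i \<in> I" for i
    using that assms(1) by (simp add: c lf_sum[OF f] lf_scale[OF f] d if_distrib cong: if_cong)
  then show ?thesis using c by simp
qed

text \<open>A computation involves finitely many vectors, and these have coordinates given by
  functionals on all of H. Hence multilinear identities reduce to products of functionals, the form
  in which \<open>teq\<close> and \<open>coassoc\<close> are given.\<close>

lemma finite_coordinates:
  assumes "finite X"
  obtains C f where "finite C" "\<forall>b. lf (f b)" "\<forall>x\<in>X. x = (\<Sum>b\<in>C. scale (f b x) b)"
proof -
  obtain C where C: "C \<subseteq> X" "independent C" "X \<subseteq> span C"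
    using maximal_independent_subset[of X] .
  have fC: "finite C" using C(1) assms by (rule finite_subset)
  obtain f where f: "\<And>b. lf (f b)" "\<And>b c. b \<in> C \<Longrightarrow> c \<in> C \<Longrightarrow> f b c = (if b = c then 1 else 0)"
    using dual_family[OF independent_imp_indep_family[OF fC C(2)]] by metis
  show ?thesis
  proof (rule that[of C f])
    show "\<forall>x\<in>X. x = (\<Sum>b\<in>C. scale (f b x) b)"
      using dual_family_expand[OF fC f(1), where x = "\<lambda>b. b"] f(2) C by auto
  qed (use fC f in auto)
qed

lemma lf_eqI:
  assumes "\<And>f. lf f \<Longrightarrow> f a = f b" shows "a = b"
proof -
  have fX: "finite {a, b}" by simp
  obtain C f where C: "finite C" and lf: "\<forall>b. lf (f b)" and ex: "\<forall>x\<in>{a, b}. x = (\<Sum>c\<in>C. scale (f c x) c)"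
    using finite_coordinates[OF fX] .
  have "a = (\<Sum>c\<in>C. scale (f c a) c)" using ex by blast
  also have "\<dots> = (\<Sum>c\<in>C. scale (f c b) c)" by (intro sum.cong refl) (simp add: assms[OF lf[rule_format]])
  also have "\<dots> = b" by (rule ex[rule_format, symmetric]) simp
  finally show ?thesis .
qed

lemma lf_nonzero:
  assumes "a \<noteq> 0" obtains f where "lf f" "f a = 1"
proof -
  have "independent {a}" using assms by simp
  then show ?thesis using lf_independent_extend[of "{a}" "\<lambda>_. 1"] that by blast
qed

section \<open>Sweedler calculus\<close>

definition bilin :: "('h \<Rightarrow> 'h \<Rightarrow> 'k) \<Rightarrow> bool" where
  "bilin B \<longleftrightarrow> (\<forall>y. lf (\<lambda>x. B x y)) \<and> (\<forall>x. lf (B x))"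

lemma bilin1: "bilin B \<Longrightarrow> lf (\<lambda>x. B x y)" and bilin2: "bilin B \<Longrightarrow> lf (B x)"
  by (auto simp: bilin_def)

lemma bilinI: "(\<And>y. lf (\<lambda>x. B x y)) \<Longrightarrow> (\<And>x. lf (\<lambda>y. B x y)) \<Longrightarrow> bilin B"
  by (auto simp: bilin_def)

lemma lf_comp: "lf f \<Longrightarrow> lm g \<Longrightarrow> lf (\<lambda>x. f (g x))"
  by (auto simp: lin_fun_def lin_map_def)

lemma lf_mult_const: "lf f \<Longrightarrow> lf (\<lambda>x. f x * c)" and lf_const_mult: "lf f \<Longrightarrow> lf (\<lambda>x. c * f x)"
  by (auto simp: lin_fun_def algebra_simps)

lemma lf_sum_fun: "(\<And>i. i \<in> I \<Longrightarrow> lf (f i)) \<Longrightarrow> lf (\<lambda>x. \<Sum>i\<in>I. f i x)"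
  by (auto simp: lin_fun_def sum.distrib sum_distrib_left)

lemma lm_id: "lm (\<lambda>x. x)" by (auto simp: lin_map_def)

lemma lm_mult_left: "lm g \<Longrightarrow> lm (\<lambda>x. a * g x)"
  by (auto simp: lin_map_def distrib_left scale_mult_right[symmetric])

lemma lm_mult_right: "lm g \<Longrightarrow> lm (\<lambda>x. g x * a)"
  by (auto simp: lin_map_def distrib_right scale_mult_left[symmetric])

lemma lm_comp: "lm h \<Longrightarrow> lm g \<Longrightarrow> lm (\<lambda>x. h (g x))"
  by (auto simp: lin_map_def)

lemmas lin_intros = bilinI lf_mult_const lf_const_mult lm_id lm_mult_left lm_mult_right
  lm_comp[OF antipode_lin] lf_comp[OF counit_lin]

text \<open>Sweedler's notation: \<^term>\<open>D B a\<close> is the sum of \<open>B(a\<^sub>1, a\<^sub>2)\<close>.\<close>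

definition D :: "('h \<Rightarrow> 'h \<Rightarrow> 'k) \<Rightarrow> 'h \<Rightarrow> 'k" where
  "D B a = (\<Sum>(x, y)\<leftarrow>comult a. B x y)"

lemma lf_expand:
  assumes "lf g" "x = (\<Sum>b\<in>C. scale (f b x) b)" shows "g x = (\<Sum>b\<in>C. f b x * g b)"
  using arg_cong[OF assms(2), of g] by (simp add: lf_sum[OF assms(1)] lf_scale[OF assms(1)])

lemma bilin_expand:
  assumes B: "bilin B" and x: "x = (\<Sum>b\<in>C. scale (f b x) b)" and y: "y = (\<Sum>b\<in>C. scale (f b y) b)"
  shows "B x y = (\<Sum>b\<in>C. \<Sum>c\<in>C. B b c * (f b x * f c y))"
  by (subst lf_expand[OF bilin1[OF B], where f = f, OF x]) (simp add: lf_expand[OF bilin2[OF B], where f = f, OF y] sum_distrib_left mult_ac)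

text \<open>\<open>teq\<close> tests only forms \<open>f \<otimes> g\<close>; on the finitely many
  legs of \<open>t\<close> and \<open>u\<close> every bilinear form is a linear combination of such
  forms.\<close>

lemma teq_bilin:
  assumes "teq scale t u" "bilin B"
  shows "(\<Sum>(x, y)\<leftarrow>t. B x y) = (\<Sum>(x, y)\<leftarrow>u. B x y)"
proof -
  let ?X = "fst ` set (t @ u) \<union> snd ` set (t @ u)"
  have fX: "finite ?X" by simp
  obtain C f where C: "finite C" and lf: "\<forall>b. lf (f b)" and ex: "\<forall>x\<in>?X. x = (\<Sum>b\<in>C. scale (f b x) b)"
    using finite_coordinates[OF fX] .
  note Cf = C lf[rule_format] ex[rule_format]
  have *: "(\<Sum>(x, y)\<leftarrow>s. B x y) = (\<Sum>b\<in>C. \<Sum>c\<in>C. B b c * teval (f b) (f c) s)"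
    if "set s \<subseteq> set (t @ u)" for s
  proof -
    have "(\<Sum>(x, y)\<leftarrow>s. B x y) = (\<Sum>(x, y)\<leftarrow>s. \<Sum>b\<in>C. \<Sum>c\<in>C. B b c * (f b x * f c y))"
      by (rule sum_list_pair_cong, rule bilin_expand[OF assms(2)]; rule Cf(3))
         (use that in \<open>force+\<close>)
    then show ?thesis
      by (simp add: sum_list_sum_swap sum_list_pair_mult_left teval_def)
  qed
  have "teval (f b) (f c) t = teval (f b) (f c) u" for b c
    using assms(1) Cf(2) by (auto simp: teq_def)
  then show ?thesis by (simp add: *)
qed

lemma bilin_prod: "lf f \<Longrightarrow> lf g \<Longrightarrow> bilin (\<lambda>x y. f x * g y)"
  by (intro lin_intros)

lemma teqI:
  assumes "\<And>B. bilin B \<Longrightarrow> (\<Sum>(x, y)\<leftarrow>t. B x y) = (\<Sum>(x, y)\<leftarrow>u. B x y)"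
  shows "teq scale t u"
  unfolding teq_def teval_def using assms bilin_prod by blast

lemma teq_comult_D: "teq scale t (comult a) \<Longrightarrow> bilin B \<Longrightarrow> (\<Sum>(x, y)\<leftarrow>t. B x y) = D B a"
  unfolding D_def by (rule teq_bilin)

lemma D_add: "bilin B \<Longrightarrow> D B (a + b) = D B a + D B b"
  using teq_bilin[OF comult_add] by (simp add: D_def)

lemma D_scale: "bilin B \<Longrightarrow> D B (scale c a) = c * D B a"
proof -
  assume B: "bilin B"
  have "D B (scale c a) = (\<Sum>(x, y)\<leftarrow>map (\<lambda>(x, y). (scale c x, y)) (comult a). B x y)"
    using teq_bilin[OF comult_scale B] by (simp add: D_def)
  also have "\<dots> = (\<Sum>(x, y)\<leftarrow>comult a. c * B x y)"
    by (simp add: case_prod_beta' o_def lf_scale[OF bilin1[OF B]])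
  finally show ?thesis by (simp add: sum_list_pair_mult_left D_def)
qed

lemma lf_D: "bilin B \<Longrightarrow> lf (D B)"
  by (auto simp: lin_fun_def D_add D_scale)

lemma lf_D_comp: "bilin B \<Longrightarrow> lm g \<Longrightarrow> lf (\<lambda>x. D B (g x))"
  by (rule lf_comp[OF lf_D])

lemma lf_D_arg:
  assumes "\<And>u v. lf (\<lambda>x. T x u v)" shows "lf (\<lambda>x. D (T x) a)"
proof -
  have "T (x + y) = (\<lambda>u v. T x u v + T y u v)" "T (scale c x) = (\<lambda>u v. c * T x u v)" for x y c
    using lf_add[OF assms] lf_scale[OF assms] by (auto simp: fun_eq_iff)
  then show ?thesis
    by (simp add: D_def lin_fun_def sum_list_pair_add sum_list_pair_mult_left)
qed

lemmas lin_D = lf_D_comp lf_D_arg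

lemma D_cong: "(\<And>x y. B x y = B' x y) \<Longrightarrow> D B a = D B' a"
  by (simp add: D_def)

lemma D_mult_const: "D (\<lambda>x y. c * B x y) a = c * D B a"
  by (simp add: D_def sum_list_pair_mult_left)

lemma D_sum: "D (\<lambda>x y. \<Sum>i\<in>I. B i x y) a = (\<Sum>i\<in>I. D (B i) a)"
  by (simp add: D_def sum_list_sum_swap)

lemma D_swap: "D (\<lambda>x y. D (\<lambda>u v. T x y u v) b) a = D (\<lambda>u v. D (\<lambda>x y. T x y u v) a) b"
  unfolding D_def by (rule sum_list_pair_swap)

lemma D_one: "bilin B \<Longrightarrow> D B 1 = B 1 1"
  using teq_bilin[OF comult_one] by (simp add: D_def)

lemma D_mult:
  assumes "bilin B"
  shows "D B (a * b) = D (\<lambda>x y. D (\<lambda>x' y'. B (x * x') (y * y')) b) a"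
proof -
  have "(\<Sum>(x, y)\<leftarrow>tmult t u. B x y) = (\<Sum>(x, y)\<leftarrow>t. \<Sum>(x', y')\<leftarrow>u. B (x * x') (y * y'))" for t u
    by (induction t) (auto simp: tmult_def case_prod_beta' o_def)
  then show ?thesis using teq_bilin[OF comult_mult assms] by (simp add: D_def)
qed

lemma D_counit_left: "lf f \<Longrightarrow> D (\<lambda>x y. counit x * f y) a = f a"
  using arg_cong[OF counit_left, of f a] by (simp add: lf_sum_list lf_scale D_def)

lemma D_counit_right: "lf f \<Longrightarrow> D (\<lambda>x y. counit y * f x) a = f a"
  using arg_cong[OF counit_right, of f a] by (simp add: lf_sum_list lf_scale D_def)

lemma D_antipode_left: "lf f \<Longrightarrow> D (\<lambda>x y. f (S x * y)) a = counit a * f 1"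
  using arg_cong[OF antipode_left, of f a] by (simp add: lf_sum_list lf_scale D_def)

lemma D_antipode_right: "lf f \<Longrightarrow> D (\<lambda>x y. f (x * S y)) a = counit a * f 1"
  using arg_cong[OF antipode_right, of f a] by (simp add: lf_sum_list lf_scale D_def)

text \<open>Lifts the axiom \<open>coassoc\<close> from products of three functionals to all
  trilinear \<open>T\<close> by coordinates.\<close>

lemma D_coassoc:
  assumes T1: "\<And>v y. lf (\<lambda>u. T u v y)" and T2: "\<And>u y. lf (\<lambda>v. T u v y)" and T3: "\<And>u v. lf (\<lambda>y. T u v y)"
  shows "D (\<lambda>x y. D (\<lambda>u v. T u v y) x) a = D (\<lambda>x y. D (\<lambda>u v. T x u v) y) a"
proof -
  define legs where "legs = (\<lambda>x. fst ` set (comult x) \<union> snd ` set (comult x))"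
  \<comment> \<open>\<open>X\<close> also holds the legs of the coproducts of the legs, since both
    bracketings of the iterated coproduct occur.\<close>
  define X where "X = legs a \<union> (\<Union>x\<in>legs a. legs x)"
  have lg: "x \<in> legs c \<and> y \<in> legs c" if "(x, y) \<in> set (comult c)" for x y c
    using imageI[OF that, of fst] imageI[OF that, of snd] by (simp add: legs_def)
  have legs: "x \<in> X" "y \<in> X" "x \<in> legs a" "y \<in> legs a" if "(x, y) \<in> set (comult a)" for x y
    using lg[OF that] by (auto simp: X_def)
  have legs2: "u \<in> X" "v \<in> X" if "(u, v) \<in> set (comult x)" "x \<in> legs a" for u v x
    using lg[OF that(1)] that(2) by (auto simp: X_def)
  have fX: "finite X" by (simp add: X_def legs_def)
  obtain C f where C: "finite C" and lf: "\<forall>b. lf (f b)" and ex: "\<forall>x\<in>X. x = (\<Sum>b\<in>C. scale (f b x) b)"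
    using finite_coordinates[OF fX] .
  note Cf = C lf[rule_format] ex[rule_format]
  have ex: "T u v y = (\<Sum>b\<in>C. \<Sum>c\<in>C. \<Sum>d\<in>C. T b c d * (f b u * f c v * f d y))"
    if "u \<in> X" "v \<in> X" "y \<in> X" for u v y
  proof -
    note e = Cf(3)[OF that(1)] Cf(3)[OF that(2)] Cf(3)[OF that(3)]
    show ?thesis
      by (subst lf_expand[OF T1, where f = f, OF e(1)], subst lf_expand[OF T2, where f = f, OF e(2)])
         (simp add: lf_expand[OF T3, where f = f, OF e(3)] sum_distrib_left mult_ac)
  qed
  have "D (\<lambda>x y. D (\<lambda>u v. T u v y) x) a =
      (\<Sum>(x, y)\<leftarrow>comult a. \<Sum>(u, v)\<leftarrow>comult x. \<Sum>b\<in>C. \<Sum>c\<in>C. \<Sum>d\<in>C. T b c d * (f b u * f c v * f d y))"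
    unfolding D_def by (intro sum_list_pair_cong ex) (auto intro: legs legs2)
  also have "\<dots> = (\<Sum>b\<in>C. \<Sum>c\<in>C. \<Sum>d\<in>C. T b c d *
      (\<Sum>(x, y)\<leftarrow>comult a. (\<Sum>(u, v)\<leftarrow>comult x. f b u * f c v) * f d y))"
    by (simp add: sum_list_sum_swap sum_list_pair_mult_left sum_list_pair_mult_right)
  also have "\<dots> = (\<Sum>b\<in>C. \<Sum>c\<in>C. \<Sum>d\<in>C. T b c d *
      (\<Sum>(x, y)\<leftarrow>comult a. f b x * (\<Sum>(u, v)\<leftarrow>comult y. f c u * f d v)))"
    by (simp only: coassoc[OF Cf(2) Cf(2) Cf(2)])
  also have "\<dots> = (\<Sum>(x, y)\<leftarrow>comult a. \<Sum>(u, v)\<leftarrow>comult y. \<Sum>b\<in>C. \<Sum>c\<in>C. \<Sum>d\<in>C. T b c d * (f b x * f c u * f d v))"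
    by (simp add: sum_list_sum_swap sum_list_pair_mult_left mult.assoc)
  also have "\<dots> = D (\<lambda>x y. D (\<lambda>u v. T x u v) y) a"
    unfolding D_def by (intro sum_list_pair_cong ex[symmetric]) (auto intro: legs legs2)
  finally show ?thesis .
qed

text \<open>Both sides are convolution inverses of the multiplication. The sum \<open>?E\<close> is
  \<open>f (S (a\<^sub>1 b\<^sub>1) a\<^sub>2 b\<^sub>2 S b\<^sub>3 S a\<^sub>3)\<close>; cancelling
  from the right leaves \<open>S (a * b)\<close>, cancelling from the left leaves
  \<open>S b * S a\<close>.\<close>

lemma antipode_mult: "S (a * b) = S b * S a"
proof (rule lf_eqI)
  fix f assume f: "lf f"
  note lin = lin_intros lin_D lf_comp[OF f]
  let ?E = "D (\<lambda>x y. D (\<lambda>y1 y2. D (\<lambda>u v. D (\<lambda>v1 v2. f (S (x * u) * (y1 * v1) * (S v2 * S y2))) v) b) y) a"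
  have "D (\<lambda>y1 y2. D (\<lambda>u v. D (\<lambda>v1 v2. f (S (x * u) * (y1 * v1) * (S v2 * S y2))) v) b) y
      = counit y * f (S (x * b))" for x y
  proof -
    have "D (\<lambda>v1 v2. f (S (x * u) * (y1 * v1) * (S v2 * S y2))) v
        = counit v * f (S (x * u) * (y1 * S y2))" for u v y1 y2
      using D_antipode_right[of "\<lambda>z. f (S (x * u) * (y1 * (z * S y2)))" v]
      by (simp add: mult.assoc lin)
    then have "D (\<lambda>u v. D (\<lambda>v1 v2. f (S (x * u) * (y1 * v1) * (S v2 * S y2))) v) b
        = f (S (x * b) * (y1 * S y2))" for y1 y2
      using D_counit_right[of "\<lambda>u. f (S (x * u) * (y1 * S y2))" b] by (simp add: lin)
    moreover have "D (\<lambda>y1 y2. f (S (x * b) * (y1 * S y2))) y = counit y * f (S (x * b))"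
      using D_antipode_right[of "\<lambda>z. f (S (x * b) * z)" y] by (simp add: lin)
    ultimately show ?thesis by simp
  qed
  then have "?E = f (S (a * b))"
    using D_counit_right[of "\<lambda>x. f (S (x * b))" a] by (simp add: lin)
  moreover have "?E = f (S b * S a)"
  proof -
    have "?E = D (\<lambda>z y2. D (\<lambda>x y1. D (\<lambda>u v. D (\<lambda>v1 v2. f (S (x * u) * (y1 * v1) * (S v2 * S y2))) v) b) z) a"
      by (rule D_coassoc[symmetric]; intro lin)
    also have "\<dots> = D (\<lambda>z y2. D (\<lambda>x y1. D (\<lambda>w v2. D (\<lambda>u v1. f (S (x * u) * (y1 * v1) * (S v2 * S y2))) w) b) z) a"
      by (intro D_cong D_coassoc[symmetric]; intro lin)
    also have "\<dots> = D (\<lambda>z y2. D (\<lambda>w v2. D (\<lambda>x y1. D (\<lambda>u v1. f (S (x * u) * (y1 * v1) * (S v2 * S y2))) w) z) b) a"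
      by (intro D_cong D_swap)
    also have "\<dots> = D (\<lambda>z y2. D (\<lambda>w v2. counit z * (counit w * f (S v2 * S y2))) b) a"
    proof (intro D_cong)
      fix z w v2 y2
      have "D (\<lambda>p q. f (S p * q * (S v2 * S y2))) (z * w) = counit z * (counit w * f (S v2 * S y2))"
        using D_antipode_left[of "\<lambda>p. f (p * (S v2 * S y2))" "z * w"] by (simp add: lin counit_mult)
      moreover have "D (\<lambda>p q. f (S p * q * (S v2 * S y2))) (z * w)
         = D (\<lambda>x y1. D (\<lambda>u v1. f (S (x * u) * (y1 * v1) * (S v2 * S y2))) w) z"
        by (rule D_mult) (intro lin)
      ultimately show "D (\<lambda>x y1. D (\<lambda>u v1. f (S (x * u) * (y1 * v1) * (S v2 * S y2))) w) z
          = counit z * (counit w * f (S v2 * S y2))" by simp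
    qed
    also have "\<dots> = D (\<lambda>z y2. counit z * f (S b * S y2)) a"
      using D_counit_left[of "\<lambda>v. f (S v * S _)" b] by (simp add: D_mult_const lin)
    also have "\<dots> = f (S b * S a)"
      using D_counit_left[of "\<lambda>y. f (S b * S y)" a] by (simp add: lin)
    finally show ?thesis .
  qed
  ultimately show "f (S (a * b)) = f (S b * S a)" by simp
qed

lemma antipode_one: "S 1 = 1"
proof (rule lf_eqI)
  fix f assume f: "lf f"
  have "f (S 1) = D (\<lambda>x y. f (S x * y)) 1"
    by (subst D_one) (auto intro!: lin_intros lf_comp[OF f])
  then show "f (S 1) = f 1" by (simp add: D_antipode_left[OF f] counit_one)
qed

lemma counit_antipode: "counit (S a) = counit a"
proof -
  have "counit (S a) = D (\<lambda>x y. counit (S x * y)) a"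
    using D_counit_right[of "\<lambda>x. counit (S x)" a] by (simp add: lin_intros counit_mult mult.commute)
  then show ?thesis by (simp add: D_antipode_left[OF counit_lin] counit_one)
qed

text \<open>Again uniqueness of convolution inverses, now with values in H \<otimes> H:
  \<open>?E\<close> evaluates \<open>B\<close> on \<open>\<Delta>(S a\<^sub>1) \<Delta>(a\<^sub>2)
  (S a\<^sub>4 \<otimes> S a\<^sub>3)\<close>. The last two factors cancel to the counit, and so do
  the first two.\<close>

lemma antipode_comult:
  assumes B: "bilin B"
  shows "D B (S a) = D (\<lambda>x y. B (S y) (S x)) a"
proof -
  note lin = lin_intros lin_D lf_comp[OF bilin1[OF B]] lf_comp[OF bilin2[OF B]]
  let ?E = "D (\<lambda>x y. D (\<lambda>y1 y2. D (\<lambda>p q. D (\<lambda>m n. D (\<lambda>r s. B (m * p * S s) (n * q * S r)) y2) (S x)) y1) y) a"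
  \<comment> \<open>Cancels the last two factors: first the inner pair \<open>q * S r\<close>
    collapses, then the outer pair \<open>p * S s\<close> around it.\<close>
  have conv: "D (\<lambda>y1 y2. D (\<lambda>p q. D (\<lambda>r s. B (m * p * S s) (n * q * S r)) y2) y1) y = counit y * B m n" for y m n
  proof -
    have "D (\<lambda>y1 y2. D (\<lambda>p q. D (\<lambda>r s. B (m * p * S s) (n * q * S r)) y2) y1) y
        = D (\<lambda>p w. D (\<lambda>q y2. D (\<lambda>r s. B (m * p * S s) (n * q * S r)) y2) w) y"
      by (rule D_coassoc; intro lin)
    also have "\<dots> = D (\<lambda>p w. D (\<lambda>t s. D (\<lambda>q r. B (m * p * S s) (n * q * S r)) t) w) y"
      by (intro D_cong D_coassoc[symmetric]; intro lin)
    also have "\<dots> = D (\<lambda>p w. D (\<lambda>t s. counit t * B (m * p * S s) n) w) y"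
      using D_antipode_right[of "\<lambda>z. B (m * _ * S _) (n * z)"] by (simp add: lin mult.assoc)
    also have "\<dots> = D (\<lambda>p w. B (m * p * S w) n) y"
      using D_counit_left[of "\<lambda>s. B (m * _ * S s) n"] by (simp add: lin)
    also have "\<dots> = counit y * B m n"
      using D_antipode_right[of "\<lambda>z. B (m * z) n"] by (simp add: lin mult.assoc)
    finally show ?thesis .
  qed
  have "?E = D (\<lambda>x y. D (\<lambda>m n. D (\<lambda>y1 y2. D (\<lambda>p q. D (\<lambda>r s. B (m * p * S s) (n * q * S r)) y2) y1) y) (S x)) a"
  proof (rule D_cong)
    fix x y
    have "D (\<lambda>y1 y2. D (\<lambda>p q. D (\<lambda>m n. D (\<lambda>r s. B (m * p * S s) (n * q * S r)) y2) (S x)) y1) y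
      = D (\<lambda>y1 y2. D (\<lambda>m n. D (\<lambda>p q. D (\<lambda>r s. B (m * p * S s) (n * q * S r)) y2) y1) (S x)) y"
      by (intro D_cong D_swap)
    then show "D (\<lambda>y1 y2. D (\<lambda>p q. D (\<lambda>m n. D (\<lambda>r s. B (m * p * S s) (n * q * S r)) y2) (S x)) y1) y
      = D (\<lambda>m n. D (\<lambda>y1 y2. D (\<lambda>p q. D (\<lambda>r s. B (m * p * S s) (n * q * S r)) y2) y1) y) (S x)"
      by (simp only: D_swap[of _ "S x" y])
  qed
  also have "\<dots> = D (\<lambda>x y. counit y * D B (S x)) a"
    by (simp only: conv D_mult_const)
  also have "\<dots> = D B (S a)"
    using D_counit_right[of "\<lambda>x. D B (S x)" a] B by (simp add: lf_D_comp antipode_lin)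
  finally have 1: "?E = D B (S a)" .
  have "?E = D (\<lambda>w y2. D (\<lambda>x y1. D (\<lambda>p q. D (\<lambda>m n. D (\<lambda>r s. B (m * p * S s) (n * q * S r)) y2) (S x)) y1) w) a"
    by (rule D_coassoc[symmetric]; intro lin)
  also have "\<dots> = D (\<lambda>w y2. D (\<lambda>x y1. D (\<lambda>P Q. D (\<lambda>r s. B (P * S s) (Q * S r)) y2) (S x * y1)) w) a"
  proof (intro D_cong)
    fix x y1 w y2
    have "D (\<lambda>P Q. D (\<lambda>r s. B (P * S s) (Q * S r)) y2) (S x * y1) =
       D (\<lambda>m n. D (\<lambda>p q. D (\<lambda>r s. B (m * p * S s) (n * q * S r)) y2) y1) (S x)"
      by (rule D_mult) (intro lin)
    then show "D (\<lambda>p q. D (\<lambda>m n. D (\<lambda>r s. B (m * p * S s) (n * q * S r)) y2) (S x)) y1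
      = D (\<lambda>P Q. D (\<lambda>r s. B (P * S s) (Q * S r)) y2) (S x * y1)"
      by (simp only: D_swap[of _ "S x" y1])
  qed
  also have "\<dots> = D (\<lambda>w y2. counit w * D (\<lambda>r s. B (S s) (S r)) y2) a"
  proof (intro D_cong)
    fix w y2
    have b: "bilin (\<lambda>P Q. D (\<lambda>r s. B (P * S s) (Q * S r)) y2)" by (intro lin)
    show "D (\<lambda>x y1. D (\<lambda>P Q. D (\<lambda>r s. B (P * S s) (Q * S r)) y2) (S x * y1)) w
        = counit w * D (\<lambda>r s. B (S s) (S r)) y2"
      by (subst D_antipode_left[OF lf_D[OF b]]) (simp add: D_one[OF b])
  qed
  also have "\<dots> = D (\<lambda>x y. B (S y) (S x)) a"
    by (rule D_counit_left[of "D (\<lambda>r s. B (S s) (S r))" a]) (intro lf_D lin)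
  finally show ?thesis using 1 by simp
qed

section \<open>The inverse antipode\<close>

lemma antipode_inj: "S a = S b \<Longrightarrow> a = b"
  using antipode_bij by (auto simp: bij_def inj_def)

abbreviation R :: "'h \<Rightarrow> 'h" where "R \<equiv> inv S"

lemma S_R: "S (R a) = a" and R_S: "R (S a) = a"
  using antipode_bij by (auto simp: bij_def surj_f_inv_f)

lemma lm_R: "lm R"
  unfolding lin_map_def
  by (intro conjI allI; rule antipode_inj) (simp_all add: S_R lm_add[OF antipode_lin] lm_scale[OF antipode_lin])

lemma R_mult: "R (a * b) = R b * R a"
  by (rule antipode_inj) (simp add: S_R antipode_mult)

lemmas lin_R = lm_comp[OF lm_R]

lemma antipode_indep_family:
  assumes "indep_family I x" shows "indep_family I (\<lambda>i. S (x i))"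
proof -
  have "(\<Sum>i\<in>I. scale (c i) (S (x i))) = S (\<Sum>i\<in>I. scale (c i) (x i))" for c
    by (simp add: lm_sum[OF antipode_lin] lm_scale[OF antipode_lin])
  moreover have "S z = 0 \<longleftrightarrow> z = 0" for z
    using antipode_inj[of z 0] lm_zero[OF antipode_lin] by auto
  ultimately show ?thesis using assms by (simp add: indep_family_def)
qed

section \<open>Minimal tensor representations\<close>

text \<open>A presentation of \<open>comult a\<close> over an index set rather than a list, so that
  a summand can be discarded without renumbering and the legs form families.\<close>

definition tensor_rep :: "nat set \<Rightarrow> (nat \<Rightarrow> 'h) \<Rightarrow> (nat \<Rightarrow> 'h) \<Rightarrow> 'h \<Rightarrow> bool" where
  "tensor_rep I x v a \<longleftrightarrow> finite I \<and> (\<forall>B. bilin B \<longrightarrow> D B a = (\<Sum>i\<in>I. B (x i) (v i)))"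

lemma tensor_repD: "tensor_rep I x v a \<Longrightarrow> bilin B \<Longrightarrow> D B a = (\<Sum>i\<in>I. B (x i) (v i))"
  by (simp add: tensor_rep_def)

lemma tensor_rep_of_list:
  assumes "teq scale t (comult a)"
  shows "tensor_rep {..<length t} (\<lambda>i. fst (t ! i)) (\<lambda>i. snd (t ! i)) a"
proof -
  have "(\<Sum>(x, y)\<leftarrow>t. B x y) = (\<Sum>i\<in>{..<length t}. B (fst (t ! i)) (snd (t ! i)))" for B :: "'h \<Rightarrow> 'h \<Rightarrow> 'k"
    by (simp add: case_prod_beta' sum_list_sum_nth atLeast0LessThan)
  then show ?thesis
    using teq_comult_D[OF assms, symmetric] by (simp add: tensor_rep_def)
qed

text \<open>Solving the relation for \<open>x j\<close> removes the summand \<open>j\<close>; its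
  right leg is spread over the remaining ones.\<close>

lemma tensor_rep_drop_left:
  assumes rep: "tensor_rep I x v a" and dep: "(\<Sum>i\<in>I. scale (c i) (x i)) = 0" and j: "j \<in> I" "c j \<noteq> 0"
  shows "tensor_rep (I - {j}) x (\<lambda>i. v i - scale (c i / c j) (v j)) a"
proof -
  have fin: "finite I" using rep by (simp add: tensor_rep_def)
  have "D B a = (\<Sum>i\<in>I - {j}. B (x i) (v i - scale (c i / c j) (v j)))" if B: "bilin B" for B
  proof -
    have "0 = (\<Sum>i\<in>I. c i * B (x i) (v j))"
      using arg_cong[OF dep, of "\<lambda>z. B z (v j)"] lf_zero[OF bilin1[OF B]]
      by (simp add: lf_sum[OF bilin1[OF B]] lf_scale[OF bilin1[OF B]])
    also have "\<dots> = c j * B (x j) (v j) + (\<Sum>i\<in>I - {j}. c i * B (x i) (v j))"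
      by (rule sum.remove[OF fin j(1)])
    finally have "B (x j) (v j) = - (\<Sum>i\<in>I - {j}. c i * B (x i) (v j)) / c j"
      using j(2) by (simp add: field_simps eq_neg_iff_add_eq_0)
    then have "D B a = (\<Sum>i\<in>I - {j}. B (x i) (v i)) - (\<Sum>i\<in>I - {j}. c i / c j * B (x i) (v j))"
      using tensor_repD[OF rep B] by (simp add: sum.remove[OF fin j(1)] sum_divide_distrib)
    then show ?thesis
      by (simp add: lf_diff[OF bilin2[OF B]] lf_scale[OF bilin2[OF B]] sum_subtractf)
  qed
  then show ?thesis using fin by (simp add: tensor_rep_def)
qed

lemma tensor_rep_drop_right:
  assumes rep: "tensor_rep I x v a" and dep: "(\<Sum>i\<in>I. scale (c i) (v i)) = 0" and j: "j \<in> I" "c j \<noteq> 0"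
  shows "tensor_rep (I - {j}) (\<lambda>i. x i - scale (c i / c j) (x j)) v a"
proof -
  have fin: "finite I" using rep by (simp add: tensor_rep_def)
  have "D B a = (\<Sum>i\<in>I - {j}. B (x i - scale (c i / c j) (x j)) (v i))" if B: "bilin B" for B
  proof -
    have "0 = (\<Sum>i\<in>I. c i * B (x j) (v i))"
      using arg_cong[OF dep, of "B (x j)"] lf_zero[OF bilin2[OF B]]
      by (simp add: lf_sum[OF bilin2[OF B]] lf_scale[OF bilin2[OF B]])
    also have "\<dots> = c j * B (x j) (v j) + (\<Sum>i\<in>I - {j}. c i * B (x j) (v i))"
      by (rule sum.remove[OF fin j(1)])
    finally have "B (x j) (v j) = - (\<Sum>i\<in>I - {j}. c i * B (x j) (v i)) / c j"
      using j(2) by (simp add: field_simps eq_neg_iff_add_eq_0)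
    then have "D B a = (\<Sum>i\<in>I - {j}. B (x i) (v i)) - (\<Sum>i\<in>I - {j}. c i / c j * B (x j) (v i))"
      using tensor_repD[OF rep B] by (simp add: sum.remove[OF fin j(1)] sum_divide_distrib)
    then show ?thesis
      by (simp add: lf_diff[OF bilin1[OF B]] lf_scale[OF bilin1[OF B]] sum_subtractf)
  qed
  then show ?thesis using fin by (simp add: tensor_rep_def)
qed

text \<open>Take a representation with the fewest summands: a relation among its left or among its
  right legs would permit a shorter one.\<close>

lemma minimal_tensor_rep:
  obtains I x v where "tensor_rep I x v a" "indep_family I x" "indep_family I v"
proof -
  define P where "P n \<longleftrightarrow> (\<exists>I x v. tensor_rep I x v a \<and> card I = n)" for n
  define n where "n = (LEAST n. P n)"
  have "\<exists>n. P n" using tensor_rep_of_list[of "comult a" a] by (auto simp: P_def teq_def)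
  then have "P n" unfolding n_def by (rule LeastI_ex)
  then obtain I x v where rep: "tensor_rep I x v a" and c: "card I = n" by (auto simp: P_def)
  have fin: "finite I" using rep by (simp add: tensor_rep_def)
  have min: "\<not> tensor_rep (I - {j}) x' v' a" if "j \<in> I" for j x' v'
  proof
    assume "tensor_rep (I - {j}) x' v' a"
    then have "P (card (I - {j}))" by (auto simp: P_def)
    then have "n \<le> card (I - {j})" unfolding n_def by (rule Least_le)
    then show False using c that fin by (metis card_Diff1_less not_le)
  qed
  show ?thesis
    using that[OF rep] tensor_rep_drop_left[OF rep] tensor_rep_drop_right[OF rep] min fin
    by (auto simp: indep_family_def)
qed

text \<open>Slicing with a functional dual to one leg expresses the other leg through any second representation.\<close>

lemma rep_leg_in_span:
  assumes rep: "tensor_rep I x v a" and x: "indep_family I x"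
    and rep': "tensor_rep J x' v' a" and W: "subspace W" "\<And>j. j \<in> J \<Longrightarrow> v' j \<in> W"
    and i: "i \<in> I"
  shows "v i \<in> W"
proof -
  have fin: "finite I" using rep by (simp add: tensor_rep_def)
  obtain f where f: "\<And>i. lf (f i)" "\<And>i j. i \<in> I \<Longrightarrow> j \<in> I \<Longrightarrow> f i (x j) = (if i = j then 1 else 0)"
    using dual_family[OF x] by metis
  have "v i = (\<Sum>j\<in>J. scale (f i (x' j)) (v' j))"
  proof (rule lf_eqI)
    fix g assume g: "lf g"
    have b: "bilin (\<lambda>p q. f i p * g q)" using f(1) g by (rule bilin_prod)
    have "g (v i) = (\<Sum>j\<in>I. f i (x j) * g (v j))"
      using i fin by (simp add: f(2) if_distrib[of "\<lambda>z. z * _"] cong: if_cong)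
    also have "\<dots> = (\<Sum>j\<in>J. f i (x' j) * g (v' j))"
      using tensor_repD[OF rep b] tensor_repD[OF rep' b] by simp
    finally show "g (v i) = g (\<Sum>j\<in>J. scale (f i (x' j)) (v' j))"
      by (simp add: lf_sum[OF g] lf_scale[OF g])
  qed
  then show ?thesis using W by (auto intro!: subspace_sum subspace_scale)
qed

lemma R_one: "R 1 = 1"
  by (rule antipode_inj) (simp add: S_R antipode_one)

text \<open>The inverse antipode reverses products, so it carries
  \<open>a\<^sub>1 S(a\<^sub>2)\<close> to
  \<open>a\<^sub>2 S\<^sup>-\<^sup>1(a\<^sub>1)\<close>.\<close>

lemma D_antipode_inverse:
  assumes f: "lf f" shows "D (\<lambda>x y. f (y * R x)) a = counit a * f 1"
proof -
  have "D (\<lambda>x y. f (y * R x)) a = D (\<lambda>x y. f (R (x * S y))) a"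
    by (simp add: R_mult R_S)
  then show ?thesis
    using D_antipode_right[of "\<lambda>z. f (R z)" a] by (simp add: lf_comp[OF f] lm_R R_one)
qed

section \<open>Elements of integral type\<close>

text \<open>The relation behind \<open>A_of\<close>, with \<open>b\<close> as its witness, tested on
  bilinear forms; for \<open>a = b = L\<close> it is the integral type equation.\<close>

definition absorbs :: "'h \<Rightarrow> 'h \<Rightarrow> 'h \<Rightarrow> bool" where
  "absorbs L a b \<longleftrightarrow> (\<forall>B. bilin B \<longrightarrow> D (\<lambda>x y. B x (y * L)) a = B b L)"

lemma absorbsD: "absorbs L a b \<Longrightarrow> bilin B \<Longrightarrow> D (\<lambda>x y. B x (y * L)) a = B b L"
  by (simp add: absorbs_def)

lemma absorbs_iff_teq:
  "absorbs L a b \<longleftrightarrow> teq scale (map (\<lambda>(x, y). (x, y * L)) (comult a)) [(b, L)]"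
proof -
  have *: "(\<Sum>(x, y)\<leftarrow>map (\<lambda>(x, y). (x, y * L)) (comult a). B x y) = D (\<lambda>x y. B x (y * L)) a" for B
    by (simp add: D_def case_prod_beta' o_def)
  show ?thesis
  proof
    assume "absorbs L a b"
    then show "teq scale (map (\<lambda>(x, y). (x, y * L)) (comult a)) [(b, L)]"
      by (intro teqI) (simp only: *, simp add: absorbs_def)
  next
    assume t: "teq scale (map (\<lambda>(x, y). (x, y * L)) (comult a)) [(b, L)]"
    show "absorbs L a b"
      unfolding absorbs_def using teq_bilin[OF t] by (simp only: *) simp
  qed
qed

text \<open>Taking the coproduct of the second leg of the relation turns
  \<open>S(b) L\<^sub>1 \<otimes> L\<^sub>2\<close> into \<open>S(a\<^sub>1) a\<^sub>2 L\<^sub>1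
  \<otimes> a\<^sub>3 L\<^sub>2\<close>, where \<open>S(a\<^sub>1) a\<^sub>2\<close> collapses. This
  exchange rule drives most of the later arguments.\<close>

lemma absorbs_shift:
  assumes ab: "absorbs L a b" and B: "bilin B"
  shows "D (\<lambda>x y. B x (a * y)) L = D (\<lambda>x y. B (S b * x) y) L"
proof -
  note lin = lin_intros lin_D lf_comp[OF bilin1[OF B]] lf_comp[OF bilin2[OF B]]
  have "D (\<lambda>x y. B (S b * x) y) L = D (\<lambda>r w. D (\<lambda>x y. B (S r * x) y) (w * L)) a"
    by (rule absorbsD[OF ab, symmetric]) (intro lin bilin2[OF B])
  also have "\<dots> = D (\<lambda>r w. D (\<lambda>s q. D (\<lambda>x y. B (S r * (s * x)) (q * y)) L) w) a"
    by (intro D_cong D_mult lin bilin2[OF B])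
  also have "\<dots> = D (\<lambda>p q. D (\<lambda>r s. D (\<lambda>x y. B (S r * (s * x)) (q * y)) L) p) a"
    by (rule D_coassoc[symmetric]; intro lin)
  also have "\<dots> = D (\<lambda>p q. counit p * D (\<lambda>x y. B x (q * y)) L) a"
  proof (intro D_cong)
    fix p q
    have "lf (\<lambda>z. D (\<lambda>x y. B (z * x) (q * y)) L)" by (intro lin)
    from D_antipode_left[OF this, of p]
    show "D (\<lambda>r s. D (\<lambda>x y. B (S r * (s * x)) (q * y)) L) p = counit p * D (\<lambda>x y. B x (q * y)) L"
      by (simp add: mult.assoc)
  qed
  also have "\<dots> = D (\<lambda>x y. B x (a * y)) L"
    by (rule D_counit_left) (intro lin)
  finally show ?thesis by simp
qed

text \<open>From \<open>c\<^sub>1 \<otimes> c\<^sub>2 L = 0\<close> follows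
  \<open>c\<^sub>1 \<otimes> S(c\<^sub>2) c\<^sub>3 L = 0\<close>, that is
  \<open>c \<otimes> L = 0\<close>; a functional with \<open>g L = 1\<close> isolates
  \<open>c\<close>.\<close>

lemma comult_mult_cancel:
  assumes L: "L \<noteq> 0" and z: "\<And>B. bilin B \<Longrightarrow> D (\<lambda>x y. B x (y * L)) c = 0"
  shows "c = 0"
proof (rule lf_eqI)
  fix f assume f: "lf f"
  obtain g where g: "lf g" "g L = 1" using lf_nonzero[OF L] .
  note lin = lin_intros lin_D lf_comp[OF f] lf_comp[OF g(1)] f
  have "0 = D (\<lambda>x y. D (\<lambda>p q. f p * g (S q * (y * L))) x) c"
    by (rule z[symmetric]) (intro lin)
  also have "\<dots> = D (\<lambda>p w. D (\<lambda>q y. f p * g (S q * (y * L))) w) c"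
    by (rule D_coassoc; intro lin)
  also have "\<dots> = D (\<lambda>p w. counit w * f p) c"
    using D_antipode_left[of "\<lambda>z. g (z * L)"] g by (simp add: D_mult_const mult.assoc lin mult.commute)
  also have "\<dots> = f c" by (rule D_counit_right[OF f])
  finally show "f c = f 0" by (simp add: lf_zero[OF f])
qed

text \<open>Reduces to \<open>comult_mult_cancel\<close>: multiplying out \<open>\<Delta>(c
  L\<^sub>2) (S\<^sup>-\<^sup>1(L\<^sub>1) \<otimes> 1)\<close> and cancelling
  \<open>L\<^sub>2 S\<^sup>-\<^sup>1(L\<^sub>1)\<close> gives
  \<open>c\<^sub>1 \<otimes> c\<^sub>2 L\<close>.\<close>

lemma mult_comult_cancel:
  assumes L: "L \<noteq> 0" and z: "\<And>B. bilin B \<Longrightarrow> D (\<lambda>x y. B x (c * y)) L = 0"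
  shows "c = 0"
proof (rule comult_mult_cancel[OF L])
  fix B assume B: "bilin B"
  note lin = lin_intros lin_D lin_R lf_comp[OF bilin1[OF B]] lf_comp[OF bilin2[OF B]] bilin2[OF B]
  have "0 = D (\<lambda>x y. D (\<lambda>p q. B (p * R x) q) (c * y)) L"
    by (rule z[symmetric]) (intro lin)
  also have "\<dots> = D (\<lambda>x y. D (\<lambda>c1 c2. D (\<lambda>y1 y2. B (c1 * y1 * R x) (c2 * y2)) y) c) L"
    by (intro D_cong D_mult lin)
  also have "\<dots> = D (\<lambda>c1 c2. D (\<lambda>x y. D (\<lambda>y1 y2. B (c1 * y1 * R x) (c2 * y2)) y) L) c"
    by (rule D_swap)
  also have "\<dots> = D (\<lambda>c1 c2. D (\<lambda>w y2. D (\<lambda>x y1. B (c1 * y1 * R x) (c2 * y2)) w) L) c"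
    by (intro D_cong D_coassoc[symmetric]; intro lin)
  also have "\<dots> = D (\<lambda>c1 c2. D (\<lambda>w y2. counit w * B c1 (c2 * y2)) L) c"
    using D_antipode_inverse[of "\<lambda>z. B (_ * z) _"] by (simp add: lin mult.assoc)
  also have "\<dots> = D (\<lambda>c1 c2. B c1 (c2 * L)) c"
    using D_counit_left[of "\<lambda>y. B _ (_ * y)" L] by (simp add: lin)
  finally show "D (\<lambda>x y. B x (y * L)) c = 0" by simp
qed

text \<open>Removes the existential witness from \<open>A_of\<close>: membership becomes an equation
  in \<open>a\<close> alone, from which closure properties are read off.\<close>

lemma absorbs_unique:
  assumes L: "L \<noteq> 0" "absorbs L L L" and ab: "absorbs L a b"
  shows "b = a"
proof -
  obtain g where g: "lf g" "g L = 1" using lf_nonzero[OF L(1)] .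
  have "D (\<lambda>x y. B x ((b - a) * y)) L = 0" if B: "bilin B" for B
  proof -
    note lin = lin_intros lin_D lf_comp[OF bilin1[OF B]] lf_comp[OF bilin2[OF B]] lf_comp[OF g(1)] bilin2[OF B]
    \<comment> \<open>Pairs \<open>L\<^sub>1 \<otimes> \<Delta>(a L\<^sub>2) (1 \<otimes> L)\<close>
      with \<open>B\<close> and \<open>g\<close>. Absorbing \<open>L\<^sub>3\<close> and then the
      right leg of \<open>a\<close> gives
      \<open>L\<^sub>1 \<otimes> b L\<^sub>2 \<otimes> L\<close>; moving \<open>a\<close> to the
      left leg first gives \<open>S(b) L\<^sub>1 \<otimes> L\<^sub>2 \<otimes> L\<close>, which is
      \<open>L\<^sub>1 \<otimes> a L\<^sub>2 \<otimes> L\<close>.\<close>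
    let ?E = "D (\<lambda>x y. D (\<lambda>p q. B x p * g (q * L)) (a * y)) L"
    have "?E = D (\<lambda>x y. D (\<lambda>a1 a2. D (\<lambda>y1 y2. B x (a1 * y1) * g (a2 * y2 * L)) y) a) L"
      by (intro D_cong D_mult lin)
    also have "\<dots> = D (\<lambda>a1 a2. D (\<lambda>x y. D (\<lambda>y1 y2. B x (a1 * y1) * g (a2 * y2 * L)) y) L) a"
      by (rule D_swap)
    also have "\<dots> = D (\<lambda>a1 a2. D (\<lambda>w y2. D (\<lambda>x y1. B x (a1 * y1) * g (a2 * y2 * L)) w) L) a"
      by (intro D_cong D_coassoc[symmetric]; intro lin)
    also have "\<dots> = D (\<lambda>a1 a2. D (\<lambda>x y1. B x (a1 * y1) * g (a2 * L)) L) a"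
    proof (rule D_cong)
      fix a1 a2
      have "bilin (\<lambda>w z. D (\<lambda>x y1. B x (a1 * y1) * g (a2 * z)) w)" by (intro lin)
      from absorbsD[OF L(2) this]
      show "D (\<lambda>w y2. D (\<lambda>x y1. B x (a1 * y1) * g (a2 * y2 * L)) w) L
        = D (\<lambda>x y1. B x (a1 * y1) * g (a2 * L)) L" by (simp add: mult.assoc)
    qed
    also have "\<dots> = D (\<lambda>x y1. D (\<lambda>a1 a2. B x (a1 * y1) * g (a2 * L)) a) L"
      by (rule D_swap)
    also have "\<dots> = D (\<lambda>x y1. B x (b * y1) * g L) L"
    proof (intro D_cong)
      fix x y1
      have "bilin (\<lambda>p q. B x (p * y1) * g q)" by (intro lin g)
      from absorbsD[OF ab this]
      show "D (\<lambda>a1 a2. B x (a1 * y1) * g (a2 * L)) a = B x (b * y1) * g L" .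
    qed
    finally have 1: "?E = D (\<lambda>x y. B x (b * y)) L" by (simp add: g)
    have "?E = D (\<lambda>x y. D (\<lambda>p q. B (S b * x) p * g (q * L)) y) L"
      by (rule absorbs_shift[OF ab]) (intro lin)
    also have "\<dots> = D (\<lambda>w q. D (\<lambda>x p. B (S b * x) p * g (q * L)) w) L"
      by (rule D_coassoc[symmetric]; intro lin)
    also have "\<dots> = D (\<lambda>x p. B (S b * x) p * g L) L"
      by (rule absorbsD[OF L(2)]) (intro lin g)
    also have "\<dots> = D (\<lambda>x y. B x (a * y)) L"
      using absorbs_shift[OF ab B] by (simp add: g)
    finally have 2: "?E = D (\<lambda>x y. B x (a * y)) L" .
    have "D (\<lambda>x y. B x ((b - a) * y)) L = D (\<lambda>x y. B x (b * y)) L - D (\<lambda>x y. B x (a * y)) L"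
      by (rule lf_diff) (intro lin)
    then show ?thesis using 1 2 by simp
  qed
  then show ?thesis using mult_comult_cancel[OF L(1), of "b - a"] by simp
qed

lemma integral_type_absorbs: "integral_type scale comult L \<longleftrightarrow> L \<noteq> 0 \<and> absorbs L L L"
  by (simp add: integral_type_def absorbs_iff_teq)

lemma A_of_eq:
  assumes "integral_type scale comult L" shows "A_of scale comult L = {a. absorbs L a a}"
  unfolding A_of_def absorbs_iff_teq[symmetric]
  using assms absorbs_unique by (auto simp: integral_type_absorbs)

lemma subalg_subspace: "subalg scale A \<Longrightarrow> subspace A"
  unfolding subalg_def by (intro subspaceI) (auto, metis scale_zero_left)

lemma absorbs_mult:
  assumes a: "absorbs L a a" and b: "absorbs L b b" shows "absorbs L (a * b) (a * b)"
  unfolding absorbs_def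
proof (intro allI impI)
  fix B assume B: "bilin B"
  note lin = lin_intros lin_D lf_comp[OF bilin1[OF B]] lf_comp[OF bilin2[OF B]] bilin1[OF B] bilin2[OF B]
  have "D (\<lambda>x y. B x (y * L)) (a * b) = D (\<lambda>x y. D (\<lambda>x' y'. B (x * x') (y * y' * L)) b) a"
    by (rule D_mult) (intro lin)
  also have "\<dots> = D (\<lambda>x y. B (x * b) (y * L)) a"
    using absorbsD[OF b, of "\<lambda>p q. B (_ * p) (_ * q)"] by (simp add: lin mult.assoc)
  also have "\<dots> = B (a * b) L"
    by (rule absorbsD[OF a]) (intro lin)
  finally show "D (\<lambda>x y. B x (y * L)) (a * b) = B (a * b) L" .
qed

lemma absorbing_subalg: "subalg scale {a. absorbs L a a}"
proof -
  have "bilin (\<lambda>x y. B x (y * L))" if "bilin B" for B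
    by (intro lin_intros lf_comp[OF bilin2[OF that]] bilin1[OF that])
  then show ?thesis
    by (auto simp: subalg_def absorbs_mult)
       (auto simp: absorbs_def D_one D_add D_scale lf_add[OF bilin1] lf_scale[OF bilin1])
qed

text \<open>In a representation with independent left legs the right legs are slices by dual
  functionals, and coassociativity passes absorption from \<open>a\<close> to each slice.\<close>

lemma absorbing_coideal: "left_coideal_subalg scale comult {a. absorbs L a a}"
  unfolding left_coideal_subalg_def
proof (intro conjI ballI absorbing_subalg)
  fix a assume "a \<in> {a. absorbs L a a}"
  then have a: "absorbs L a a" by simp
  obtain I x v where rep: "tensor_rep I x v a" and x: "indep_family I x" using minimal_tensor_rep .
  have fin: "finite I" using rep by (simp add: tensor_rep_def)
  obtain f where f: "\<And>i. lf (f i)" "\<And>i j. i \<in> I \<Longrightarrow> j \<in> I \<Longrightarrow> f i (x j) = (if i = j then 1 else 0)"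
    using dual_family[OF x] by metis
  have slice: "D (\<lambda>x y. f i x * g y) a = g (v i)" if "lf g" "i \<in> I" for g i
    using tensor_repD[OF rep bilin_prod[OF f(1) that(1)]] that(2) fin
    by (simp add: f(2) if_distrib[of "\<lambda>z. z * _"] cong: if_cong)
  have "absorbs L (v i) (v i)" if i: "i \<in> I" for i
    unfolding absorbs_def
  proof (intro allI impI)
    fix B assume B: "bilin B"
    note lin = lin_intros lin_D lf_comp[OF bilin1[OF B]] lf_comp[OF bilin2[OF B]] bilin1[OF B] bilin2[OF B] f(1)
    have "D (\<lambda>x y. B x (y * L)) (v i) = D (\<lambda>x y. f i x * D (\<lambda>p q. B p (q * L)) y) a"
      by (rule slice[symmetric, OF _ i]) (intro lf_D lin)
    also have "\<dots> = D (\<lambda>x y. D (\<lambda>p q. f i x * B p (q * L)) y) a"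
      by (simp add: D_mult_const)
    also have "\<dots> = D (\<lambda>w q. D (\<lambda>x p. f i x * B p (q * L)) w) a"
      by (rule D_coassoc[symmetric]; intro lin)
    also have "\<dots> = D (\<lambda>x p. f i x * B p L) a"
      by (rule absorbsD[OF a]) (intro lin)
    also have "\<dots> = B (v i) L" by (rule slice[OF bilin1[OF B] i])
    finally show "D (\<lambda>x y. B x (y * L)) (v i) = B (v i) L" .
  qed
  moreover have "teq scale (map (\<lambda>i. (x i, v i)) (sorted_list_of_set I)) (comult a)"
  proof (rule teqI)
    fix B assume "bilin B"
    from tensor_repD[OF rep this] fin
    show "(\<Sum>(x, y)\<leftarrow>map (\<lambda>i. (x i, v i)) (sorted_list_of_set I). B x y) = (\<Sum>(x, y)\<leftarrow>comult a. B x y)"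
      by (simp add: D_def o_def sum_list_distinct_conv_sum_set)
  qed
  ultimately show "\<exists>t. teq scale t (comult a) \<and> (\<forall>(x, y)\<in>set t. y \<in> {a. absorbs L a a})"
    using fin by (intro exI[of _ "map (\<lambda>i. (x i, v i)) (sorted_list_of_set I)"]) auto
qed

text \<open>Apply the counit to the first leg. For \<open>b = a\<close> this is the left integral
  property of \<open>L\<close>.\<close>

lemma absorbs_counit: "absorbs L a b \<Longrightarrow> a * L = scale (counit b) L"
proof (rule lf_eqI)
  fix f assume ab: "absorbs L a b" and f: "lf f"
  have "D (\<lambda>x y. counit x * f (y * L)) a = counit b * f L"
    by (rule absorbsD[OF ab bilin_prod[OF counit_lin f]])
  moreover have "D (\<lambda>x y. counit x * f (y * L)) a = f (a * L)"
    by (rule D_counit_left) (intro lin_intros lf_comp[OF f])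
  ultimately show "f (a * L) = f (scale (counit b) L)" by (simp add: lf_scale[OF f])
qed

text \<open>The right legs of \<open>\<Delta>(a)\<close> can be taken in \<open>A\<close>, where
  they act on \<open>L\<close> through the counit. This opens \<open>absorbs_shift\<close> to left
  integrals of arbitrary left coideal subalgebras.\<close>

lemma coideal_absorbs:
  assumes A: "left_coideal_subalg scale comult A" and L: "L \<in> L_eps scale counit A" and a: "a \<in> A"
  shows "absorbs L a a"
  unfolding absorbs_def
proof (intro allI impI)
  fix B assume B: "bilin B"
  note lin = lin_intros lf_comp[OF bilin1[OF B]] lf_comp[OF bilin2[OF B]] bilin1[OF B] bilin2[OF B]
  obtain t where t: "teq scale t (comult a)" "\<forall>(x, y)\<in>set t. y \<in> A"
    using A a by (auto simp: left_coideal_subalg_def)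
  have "D (\<lambda>x y. B x (y * L)) a = (\<Sum>(x, y)\<leftarrow>t. B x (y * L))"
    by (rule teq_comult_D[OF t(1), symmetric]) (intro lin)
  also have "\<dots> = (\<Sum>(x, y)\<leftarrow>t. counit y * B x L)"
    using t(2) L by (intro sum_list_pair_cong) (auto simp: L_eps_def lf_scale[OF bilin2[OF B]])
  also have "\<dots> = D (\<lambda>x y. counit y * B x L) a"
    by (rule teq_comult_D[OF t(1)]) (intro lin)
  also have "\<dots> = B a L" by (rule D_counit_right[OF bilin1[OF B]])
  finally show "D (\<lambda>x y. B x (y * L)) a = B a L" .
qed

section \<open>Cointegrals\<close>

lemma lf_eq_on_span:
  assumes f: "lf f" and g: "lf g" and E: "\<And>e. e \<in> E \<Longrightarrow> f e = g e" and b: "b \<in> span E"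
  shows "f b = g b"
  using b
proof (induction rule: span_induct_alt)
  case base
  show ?case by (simp add: lf_zero f g)
next
  case (step c e y)
  then show ?case by (simp add: lf_add[OF f] lf_add[OF g] lf_scale[OF f] lf_scale[OF g] E)
qed

text \<open>The cointegral condition for a functional linear on all of H, tested by functionals on
  the left leg, so that any representation of the coproduct may be used.\<close>

definition cointegral_form :: "'h set \<Rightarrow> ('h \<Rightarrow> 'k) \<Rightarrow> bool" where
  "cointegral_form A \<psi> \<longleftrightarrow> lf \<psi> \<and> (\<forall>a\<in>A. \<forall>f. lf f \<longrightarrow> D (\<lambda>x y. \<psi> y * f x) a = \<psi> a * f 1)"

lemma bilin_prod': "lf f \<Longrightarrow> lf g \<Longrightarrow> bilin (\<lambda>x y. g y * f x)"
  by (intro lin_intros)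

lemma cointegral_form_one_cointegral:
  assumes "cointegral_form A \<psi>" shows "one_cointegral scale comult A \<psi>"
proof -
  have \<psi>: "lf \<psi>" using assms by (simp add: cointegral_form_def)
  have "(\<Sum>(x, y)\<leftarrow>t. scale (\<psi> y) x) = scale (\<psi> a) 1" if a: "a \<in> A" and t: "teq scale t (comult a)" for a t
  proof (rule lf_eqI)
    fix f assume f: "lf f"
    have "f (\<Sum>(x, y)\<leftarrow>t. scale (\<psi> y) x) = (\<Sum>(x, y)\<leftarrow>t. \<psi> y * f x)"
      by (simp add: lf_sum_list[OF f] lf_scale[OF f])
    also have "\<dots> = D (\<lambda>x y. \<psi> y * f x) a"
      by (rule teq_comult_D[OF t bilin_prod'[OF f \<psi>]])
    finally show "f (\<Sum>(x, y)\<leftarrow>t. scale (\<psi> y) x) = f (scale (\<psi> a) 1)"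
      using assms a f by (simp add: cointegral_form_def lf_scale[OF f])
  qed
  then show ?thesis
    by (simp add: one_cointegral_def lin_fun_on_def lf_add[OF \<psi>] lf_scale[OF \<psi>])
qed

text \<open>\<open>one_cointegral\<close> controls its functional on \<open>A\<close> only, whereas
  \<open>D\<close> evaluates it on arbitrary legs. Prescribing the values on a basis of
  \<open>A\<close> yields a globally linear functional.\<close>

lemma one_cointegral_extend:
  assumes A: "left_coideal_subalg scale comult A" and \<phi>: "one_cointegral scale comult A \<phi>"
  obtains \<psi> where "cointegral_form A \<psi>" "\<And>a. a \<in> A \<Longrightarrow> \<psi> a = \<phi> a"
proof -
  have sA: "subspace A" using A by (auto simp: left_coideal_subalg_def intro: subalg_subspace)
  obtain E where E: "E \<subseteq> A" "independent E" "A \<subseteq> span E" using maximal_independent_subset[of A] .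
  obtain \<psi> where \<psi>: "lf \<psi>" "\<And>e. e \<in> E \<Longrightarrow> \<psi> e = \<phi> e" using lf_independent_extend[OF E(2), of \<phi>] by blast
  have lin: "\<phi> (a + b) = \<phi> a + \<phi> b" "\<phi> (scale c a) = c * \<phi> a" if "a \<in> A" "b \<in> A" for a b c
    using \<phi> that by (auto simp: one_cointegral_def lin_fun_on_def)
  have "a \<in> A \<and> \<psi> a = \<phi> a" if "a \<in> span E" for a
    using that
  proof (induction rule: span_induct_alt)
    case base
    show ?case using lin(2)[of 0 0 0] subspace_0[OF sA] by (simp add: lf_zero[OF \<psi>(1)])
  next
    case (step c e y)
    then have "e \<in> A" "scale c e \<in> A" "y \<in> A" using E(1) subspace_scale[OF sA] by auto
    then show ?case
      using step lin(1)[of "scale c e" y] lin(2)[of e e c]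
      by (simp add: \<psi>(2) lf_add[OF \<psi>(1)] lf_scale[OF \<psi>(1)] subspace_add[OF sA])
  qed
  then have eq: "\<psi> a = \<phi> a" if "a \<in> A" for a using that E(3) by auto
  have "D (\<lambda>x y. \<psi> y * f x) a = \<psi> a * f 1" if a: "a \<in> A" and f: "lf f" for a f
  proof -
    obtain t where t: "teq scale t (comult a)" "\<forall>(x, y)\<in>set t. y \<in> A"
      using A a by (auto simp: left_coideal_subalg_def)
    have "D (\<lambda>x y. \<psi> y * f x) a = (\<Sum>(x, y)\<leftarrow>t. \<psi> y * f x)"
      by (rule teq_comult_D[OF t(1) bilin_prod'[OF f \<psi>(1)], symmetric])
    also have "\<dots> = (\<Sum>(x, y)\<leftarrow>t. \<phi> y * f x)"
      using t(2) by (intro sum_list_pair_cong) (auto simp: eq)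
    also have "\<dots> = f (\<Sum>(x, y)\<leftarrow>t. scale (\<phi> y) x)"
      by (simp add: lf_sum_list[OF f] lf_scale[OF f])
    also have "(\<Sum>(x, y)\<leftarrow>t. scale (\<phi> y) x) = scale (\<phi> a) 1"
      using \<phi> a t by (simp add: one_cointegral_def)
    finally show ?thesis using a by (simp add: eq lf_scale[OF f])
  qed
  then have "cointegral_form A \<psi>" using \<psi>(1) by (simp add: cointegral_form_def)
  then show ?thesis using eq by (rule that)
qed

end

text \<open>Fixes a nonzero left integral with one representation of its coproduct whose leg
  families are both independent, as supplied by \<open>minimal_tensor_rep\<close>.\<close>

locale coideal_integral = hopf_algebra scale comult counit S
  for scale :: "'k::field \<Rightarrow> 'h::ring_1 \<Rightarrow> 'h" and comult counit S +
  fixes A :: "'h set" and L :: 'h and I :: "nat set" and x v :: "nat \<Rightarrow> 'h"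
  assumes coideal: "left_coideal_subalg scale comult A"
    and integral: "L \<in> L_eps scale counit A"
    and nonzero: "L \<noteq> 0"
    and rep: "tensor_rep I x v L"
    and indep_x: "indep_family I x"
    and indep_v: "indep_family I v"
begin

section \<open>Legs of the coproduct of a left integral\<close>

lemma fin: "finite I" using rep by (simp add: tensor_rep_def)

lemma subspace_A: "subspace A"
  using coideal by (auto simp: left_coideal_subalg_def intro: subalg_subspace)

lemma A_one: "1 \<in> A" and A_mult: "a \<in> A \<Longrightarrow> b \<in> A \<Longrightarrow> a * b \<in> A"
  using coideal by (auto simp: left_coideal_subalg_def subalg_def)

lemmas A_add = subspace_add[OF subspace_A] and A_scale = subspace_scale[OF subspace_A]
  and A_sum = subspace_sum[OF subspace_A] and A_diff = subspace_diff[OF subspace_A]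
  and A_zero = subspace_0[OF subspace_A]

lemma L_in: "L \<in> A" and mult_L: "a \<in> A \<Longrightarrow> a * L = scale (counit a) L"
  using integral by (auto simp: L_eps_def)

lemma D_L: "bilin B \<Longrightarrow> D B L = (\<Sum>i\<in>I. B (x i) (v i))"
  by (rule tensor_repD[OF rep])

lemma v_in: "i \<in> I \<Longrightarrow> v i \<in> A"
proof -
  obtain t where t: "teq scale t (comult L)" "\<forall>(x, y)\<in>set t. y \<in> A"
    using coideal L_in by (auto simp: left_coideal_subalg_def)
  have "snd (t ! j) \<in> A" if "j < length t" for j
    using t(2) nth_mem[OF that] by (cases "t ! j") auto
  then show "i \<in> I \<Longrightarrow> v i \<in> A"
    using rep_leg_in_span[OF rep indep_x tensor_rep_of_list[OF t(1)] subspace_A] by auto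
qed

lemma shift: "a \<in> A \<Longrightarrow> bilin B \<Longrightarrow> D (\<lambda>x y. B x (a * y)) L = D (\<lambda>x y. B (S a * x) y) L"
  by (rule absorbs_shift[OF coideal_absorbs[OF coideal integral]])

text \<open>The exchange rule moves \<open>a\<close> to the left leg as \<open>S a\<close>; then the
  cointegral property collapses \<open>L\<^sub>1 \<otimes> L\<^sub>2\<close> to
  \<open>\<psi>(L) 1\<close>.\<close>

lemma cointegral_slice:
  assumes \<psi>: "cointegral_form A \<psi>" and a: "a \<in> A"
  shows "(\<Sum>i\<in>I. scale (\<psi> (a * v i)) (x i)) = scale (\<psi> L) (S a)"
proof (rule lf_eqI)
  fix f assume f: "lf f"
  have l: "lf \<psi>" using \<psi> by (simp add: cointegral_form_def)
  note lin = lin_intros lf_comp[OF f] lf_comp[OF l] f l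
  have "f (\<Sum>i\<in>I. scale (\<psi> (a * v i)) (x i)) = (\<Sum>i\<in>I. \<psi> (a * v i) * f (x i))"
    by (simp add: lf_sum[OF f] lf_scale[OF f])
  also have "\<dots> = D (\<lambda>x y. \<psi> (a * y) * f x) L"
    by (rule D_L[symmetric]) (intro lin)
  also have "\<dots> = D (\<lambda>x y. \<psi> y * f (S a * x)) L"
    by (rule shift[OF a]) (intro lin)
  also have "\<dots> = \<psi> L * f (S a * 1)"
  proof -
    have "lf (\<lambda>x. f (S a * x))" by (intro lin)
    then show ?thesis using \<psi> L_in by (simp add: cointegral_form_def)
  qed
  finally show "f (\<Sum>i\<in>I. scale (\<psi> (a * v i)) (x i)) = f (scale (\<psi> L) (S a))"
    by (simp add: lf_scale[OF f])
qed

lemma cointegral_slice_inverse: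
  assumes \<psi>: "cointegral_form A \<psi>" and a: "a \<in> A"
  shows "(\<Sum>i\<in>I. scale (\<psi> (a * v i)) (R (x i))) = scale (\<psi> L) a"
  using arg_cong[OF cointegral_slice[OF assms], of R]
  by (simp add: lm_sum[OF lm_R] lm_scale[OF lm_R] R_S)

text \<open>Dividing \<open>cointegral_slice_inverse\<close> by \<open>\<psi> L\<close> writes every
  \<open>a\<close> through the \<open>R (x i)\<close>. The \<open>v i\<close> are equally many
  independent vectors of \<open>A\<close>, so \<open>indep_family_spans\<close> turns the inclusions
  into equalities.\<close>

lemma A_spans:
  assumes \<psi>: "cointegral_form A \<psi>" and L: "\<psi> L \<noteq> 0"
  shows "span (v ` I) = A" "span ((\<lambda>i. R (x i)) ` I) = A"
proof -
  have "a \<in> span ((\<lambda>i. R (x i)) ` I)" if a: "a \<in> A" for a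
  proof -
    have "a = scale (inverse (\<psi> L)) (scale (\<psi> L) a)" using L by simp
    also have "scale (\<psi> L) a = (\<Sum>i\<in>I. scale (\<psi> (a * v i)) (R (x i)))"
      by (rule cointegral_slice_inverse[OF \<psi> a, symmetric])
    also have "scale (inverse (\<psi> L)) \<dots> \<in> span ((\<lambda>i. R (x i)) ` I)"
      by (intro span_scale span_sum span_base) auto
    finally show ?thesis .
  qed
  then have sub: "A \<subseteq> span ((\<lambda>i. R (x i)) ` I)" by blast
  show "span (v ` I) = A" "span ((\<lambda>i. R (x i)) ` I) = A"
    using indep_family_spans[OF indep_v subspace_A v_in sub] by auto
qed

lemma Rx_in: "cointegral_form A \<psi> \<Longrightarrow> \<psi> L \<noteq> 0 \<Longrightarrow> i \<in> I \<Longrightarrow> R (x i) \<in> A"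
  using A_spans(2) span_base[of "R (x i)" "(\<lambda>i. R (x i)) ` I"] by auto

text \<open>Testing against the \<open>v i\<close> suffices: if all \<open>\<psi> (a * v i)\<close>
  vanish, the slice formula reads \<open>\<psi>(L) a = 0\<close>.\<close>

lemma cointegral_faithful:
  assumes \<psi>: "cointegral_form A \<psi>" and L: "\<psi> L \<noteq> 0"
  shows "faithful_on A \<psi>"
  unfolding faithful_on_def
proof (intro ballI impI)
  fix a assume a: "a \<in> A" "\<forall>b\<in>A. \<psi> (a * b) = 0"
  then have "scale (\<psi> L) a = 0"
    using cointegral_slice_inverse[OF \<psi> a(1)] v_in by simp
  then show "a = 0" using L by simp
qed

text \<open>At \<open>a = 1\<close> the slices of \<open>\<psi>\<close> and \<open>\<chi>\<close>
  are multiples of \<open>1\<close>, hence proportional; independence of the left legs transfers the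
  proportion to the values on the \<open>v i\<close>, which span \<open>A\<close>.\<close>

lemma cointegral_unique:
  assumes \<psi>: "cointegral_form A \<psi>" and L: "\<psi> L \<noteq> 0" and \<chi>: "cointegral_form A \<chi>" and a: "a \<in> A"
  shows "\<chi> a = \<chi> L / \<psi> L * \<psi> a"
proof -
  have l: "lf \<psi>" "lf \<chi>" using \<psi> \<chi> by (auto simp: cointegral_form_def)
  have "\<psi> L * \<chi> (v i) - \<chi> L * \<psi> (v i) = 0" if "i \<in> I" for i
  proof (rule indep_familyD[OF indep_x _ that])
    have "(\<Sum>i\<in>I. scale (\<psi> L * \<chi> (v i)) (x i)) = (\<Sum>i\<in>I. scale (\<chi> L * \<psi> (v i)) (x i))"
      using arg_cong[OF cointegral_slice[OF \<chi> A_one], of "scale (\<psi> L)"]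
        arg_cong[OF cointegral_slice[OF \<psi> A_one], of "scale (\<chi> L)"]
      by (simp add: scale_sum_right mult.commute)
    then show "(\<Sum>i\<in>I. scale (\<psi> L * \<chi> (v i) - \<chi> L * \<psi> (v i)) (x i)) = 0"
      by (simp add: scale_left_diff_distrib sum_subtractf)
  qed
  then have "\<chi> (v i) = \<chi> L / \<psi> L * \<psi> (v i)" if "i \<in> I" for i
    using that L by (simp add: field_simps)
  then show ?thesis
    using lf_eq_on_span[OF l(2) lf_const_mult[OF l(1)], of "v ` I" "\<chi> L / \<psi> L" a] A_spans(1)[OF \<psi> L] a by auto
qed

section \<open>Unimodularity and the antipode\<close>

lemma antipode_integral:
  assumes \<psi>: "cointegral_form A \<psi>" and L: "\<psi> L \<noteq> 0" and r: "L \<in> R_eps scale counit A"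
  shows "S L = L"
proof -
  have l: "lf \<psi>" using \<psi> by (simp add: cointegral_form_def)
  have "scale (\<psi> L) (S L) = (\<Sum>i\<in>I. scale (\<psi> (L * v i)) (x i))"
    by (rule cointegral_slice[OF \<psi> L_in, symmetric])
  also have "\<dots> = (\<Sum>i\<in>I. scale (counit (v i) * \<psi> L) (x i))"
    using r v_in by (intro sum.cong) (auto simp: R_eps_def lf_scale[OF l])
  also have "\<dots> = scale (\<psi> L) (\<Sum>i\<in>I. scale (counit (v i)) (x i))"
    by (simp add: scale_sum_right mult.commute)
  also have "(\<Sum>i\<in>I. scale (counit (v i)) (x i)) = L"
  proof (rule lf_eqI)
    fix f assume f: "lf f"
    show "f (\<Sum>i\<in>I. scale (counit (v i)) (x i)) = f L"
      using D_L[OF bilin_prod'[OF f counit_lin]] D_counit_right[OF f, of L]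
      by (simp add: lf_sum[OF f] lf_scale[OF f])
  qed
  finally show ?thesis using L by simp
qed

text \<open>\<open>S\<close> swaps the tensor factors, so invariance of \<open>L\<close> yields a
  second representation of the same coproduct, to be compared with the first by
  \<open>rep_leg_in_span\<close>.\<close>

lemma antipode_rep:
  assumes "S L = L" shows "tensor_rep I (\<lambda>i. S (v i)) (\<lambda>i. S (x i)) L"
  unfolding tensor_rep_def
proof (intro conjI fin allI impI)
  fix B assume B: "bilin B"
  have "D B L = D (\<lambda>x y. B (S y) (S x)) L"
    using antipode_comult[OF B, of L] assms by simp
  also have "\<dots> = (\<Sum>i\<in>I. B (S (v i)) (S (x i)))"
    by (rule D_L) (intro lin_intros lf_comp[OF bilin1[OF B]] lf_comp[OF bilin2[OF B]])
  finally show "D B L = (\<Sum>i\<in>I. B (S (v i)) (S (x i)))" .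
qed

lemma antipode_square_A:
  assumes \<psi>: "cointegral_form A \<psi>" and L: "\<psi> L \<noteq> 0" and SL: "S L = L"
  shows "(S \<circ> S) ` A = A"
proof -
  have SS: "lm (\<lambda>z. S (S z))" by (intro lm_comp[OF antipode_lin] antipode_lin)
  have sub: "subspace ((S \<circ> S) ` A)"
  proof (rule subspaceI)
    show "0 \<in> (S \<circ> S) ` A" using A_zero lm_zero[OF SS] by force
  next
    fix y z assume "y \<in> (S \<circ> S) ` A" "z \<in> (S \<circ> S) ` A"
    then obtain a b where "a \<in> A" "b \<in> A" "y = S (S a)" "z = S (S b)" by auto
    then show "y + z \<in> (S \<circ> S) ` A"
      by (intro image_eqI[of _ _ "a + b"]) (auto simp: A_add lm_add[OF SS])
  next
    fix c z assume "z \<in> (S \<circ> S) ` A"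
    then obtain b where "b \<in> A" "z = S (S b)" by auto
    then show "scale c z \<in> (S \<circ> S) ` A"
      by (intro image_eqI[of _ _ "scale c b"]) (auto simp: A_scale lm_scale[OF SS])
  qed
  \<comment> \<open>\<open>S (x i)\<close> is the squared antipode of \<open>R (x i)\<close>, so the
    second representation has its right legs in the image of \<open>A\<close>; hence the
    \<open>v i\<close> lie there too.\<close>
  have Sx: "S (x i) \<in> (S \<circ> S) ` A" if "i \<in> I" for i
    using Rx_in[OF \<psi> L that] by (intro image_eqI[of _ _ "R (x i)"]) (auto simp: S_R)
  have "v i \<in> (S \<circ> S) ` A" if "i \<in> I" for i
    by (rule rep_leg_in_span[OF rep indep_x antipode_rep[OF SL] sub Sx that])
  then have "span (v ` I) \<subseteq> (S \<circ> S) ` A" by (intro span_minimal sub) auto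
  moreover have "S (S a) \<in> A" if a: "a \<in> A" for a
  proof -
    obtain c where c: "a = (\<Sum>i\<in>I. scale (c i) (R (x i)))"
      using span_image_family[OF fin, of a "\<lambda>i. R (x i)"] A_spans(2)[OF \<psi> L] a by auto
    \<comment> \<open>Opposite comparison: the left legs \<open>S (v i)\<close> of the second
      representation are independent, and the right legs \<open>v i\<close> of the first lie in
      \<open>A\<close>.\<close>
    have "S (x i) \<in> A" if "i \<in> I" for i
      by (rule rep_leg_in_span[OF antipode_rep[OF SL] antipode_indep_family[OF indep_v] rep subspace_A v_in that])
    then show ?thesis
      by (auto simp: c lm_sum[OF SS] lm_scale[OF SS] S_R intro!: A_sum A_scale)
  qed
  ultimately show ?thesis using A_spans(1)[OF \<psi> L] by auto
qed

section \<open>Idempotent integrals\<close>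

text \<open>With \<open>counit L = 1\<close> one has
  \<open>S(a) = S(a) L\<^sub>1 S(L\<^sub>2)\<close>, and the exchange rule keeps each
  \<open>S a * x i\<close> in the span of the \<open>x j\<close>. So \<open>A\<close> lies in the
  span of the finitely many \<open>R (x j * S (v i))\<close>.\<close>

lemma finite_basis:
  assumes "counit L = 1"
  obtains E where "finite E" "independent E" "E \<subseteq> A" "span E = A"
proof -
  obtain g where g: "\<And>i. lf (g i)" "\<And>i j. i \<in> I \<Longrightarrow> j \<in> I \<Longrightarrow> g i (v j) = (if i = j then 1 else 0)"
    using dual_family[OF indep_v] by metis
  let ?F = "(\<lambda>(j, i). R (x j * S (v i))) ` (I \<times> I)"
  have "a \<in> span ?F" if a: "a \<in> A" for a
  proof -
    \<comment> \<open>Slice the exchange rule with the functional dual to \<open>v i\<close>; this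
      isolates the left leg \<open>x i\<close>.\<close>
    have Sax: "S a * x i = (\<Sum>j\<in>I. scale (g i (a * v j)) (x j))" if i: "i \<in> I" for i
    proof (rule lf_eqI)
      fix f assume f: "lf f"
      note lin = lin_intros lf_comp[OF f] lf_comp[OF g(1)] f g(1)
      have "f (S a * x i) = (\<Sum>j\<in>I. g i (v j) * f (S a * x j))"
        using i fin by (simp add: g(2) if_distrib[of "\<lambda>z. z * _"] cong: if_cong)
      also have "\<dots> = D (\<lambda>x y. g i y * f (S a * x)) L" by (rule D_L[symmetric]) (intro lin)
      also have "\<dots> = D (\<lambda>x y. g i (a * y) * f x) L" by (rule shift[OF a, symmetric]) (intro lin)
      also have "\<dots> = (\<Sum>j\<in>I. g i (a * v j) * f (x j))" by (rule D_L) (intro lin)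
      finally show "f (S a * x i) = f (\<Sum>j\<in>I. scale (g i (a * v j)) (x j))"
        by (simp add: lf_sum[OF f] lf_scale[OF f])
    qed
    have "S a = (\<Sum>i\<in>I. S a * x i * S (v i))"
    proof (rule lf_eqI)
      fix f assume f: "lf f"
      note lin = lin_intros lf_comp[OF f] f
      have "f (S a) = D (\<lambda>x y. f (S a * (x * S y))) L"
        using D_antipode_right[of "\<lambda>z. f (S a * z)" L] assms by (simp add: lin)
      also have "\<dots> = (\<Sum>i\<in>I. f (S a * (x i * S (v i))))" by (rule D_L) (intro lin)
      finally show "f (S a) = f (\<Sum>i\<in>I. S a * x i * S (v i))"
        by (simp add: lf_sum[OF f] mult.assoc)
    qed
    also have "\<dots> = (\<Sum>i\<in>I. \<Sum>j\<in>I. scale (g i (a * v j)) (x j * S (v i)))"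
      by (simp add: Sax sum_distrib_right scale_mult_left)
    finally have Sa: "S a = (\<Sum>i\<in>I. \<Sum>j\<in>I. scale (g i (a * v j)) (x j * S (v i)))" .
    have "a = (\<Sum>i\<in>I. \<Sum>j\<in>I. scale (g i (a * v j)) (R (x j * S (v i))))"
      using arg_cong[OF Sa, of R] by (simp add: R_S lm_sum[OF lm_R] lm_scale[OF lm_R])
    also have "\<dots> \<in> span ?F"
      by (intro span_sum span_scale span_base) auto
    finally show ?thesis .
  qed
  then have AF: "A \<subseteq> span ?F" by blast
  obtain E where E: "E \<subseteq> A" "independent E" "A \<subseteq> span E" using maximal_independent_subset[of A] .
  have "finite E"
    using independent_span_bound[of ?F E] E AF fin by auto
  moreover have "span E = A" using E span_minimal[OF E(1) subspace_A] by auto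
  ultimately show ?thesis using that E by blast
qed

text \<open>Frobenius argument: \<open>A\<close> is finite-dimensional, so faithfulness makes the
  map from \<open>a\<close> to the functional \<open>b \<mapsto> \<psi> (a * b)\<close> bijective
  onto the dual. The preimage \<open>M\<close> of the counit is a right integral, by
  multiplicativity of the counit and faithfulness.\<close>

lemma faithful_right_integral:
  assumes \<psi>: "cointegral_form A \<psi>" and faithful: "faithful_on A \<psi>" and eps: "counit L = 1"
  obtains M where "M \<in> R_eps scale counit A" "\<And>b. b \<in> A \<Longrightarrow> \<psi> (M * b) = counit b"
proof -
  have l: "lf \<psi>" using \<psi> by (simp add: cointegral_form_def)
  obtain E where E: "finite E" "independent E" "E \<subseteq> A" "span E = A" using finite_basis[OF eps] .
  \<comment> \<open>Encodes the functional \<open>b \<mapsto> \<psi> (a * b)\<close> by the vector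
    whose coordinates are its values on the basis \<open>E\<close>, so that surjectivity becomes a
    spanning statement inside \<open>A\<close>.\<close>
  define T where "T a = (\<Sum>e\<in>E. scale (\<psi> (a * e)) e)" for a
  have T: "T (\<Sum>e\<in>E. scale (c e) e) = (\<Sum>e\<in>E. scale (c e) (T e))" for c
  proof -
    have "lf (\<lambda>a. \<psi> (a * e))" for e by (intro lin_intros lf_comp[OF l])
    then have "lm T"
      by (auto simp: lin_map_def T_def lf_add lf_scale scale_left_distrib sum.distrib scale_sum_right
          distrib_right scale_mult_left[symmetric] lf_add[OF l] lf_scale[OF l])
    then show ?thesis by (simp add: lm_sum lm_scale)
  qed
  have T_zero: "a = 0" if "a \<in> A" "T a = 0" for a
  proof -
    have "\<psi> (a * e) = 0" if "e \<in> E" for e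
      using indep_familyD[OF independent_imp_indep_family[OF E(1,2)], of "\<lambda>e. \<psi> (a * e)" e] \<open>T a = 0\<close> that
      by (simp add: T_def)
    then have "\<psi> (a * b) = 0" if "b \<in> A" for b
      using lf_eq_on_span[of "\<lambda>b. \<psi> (a * b)" "\<lambda>b. 0" E b] that E(4)
      by (simp add: lf_comp[OF l] lm_mult_left lm_id) (simp add: lin_fun_def)
    then show ?thesis using faithful \<open>a \<in> A\<close> by (auto simp: faithful_on_def)
  qed
  have comb: "(\<Sum>e\<in>E. scale (c e) e) \<in> A" for c using E(3) by (intro A_sum A_scale) auto
  have "indep_family E T"
    unfolding indep_family_def
  proof (intro conjI E(1) allI impI)
    fix c assume "(\<Sum>e\<in>E. scale (c e) (T e)) = 0"
    then have "(\<Sum>e\<in>E. scale (c e) e) = 0" using T_zero[OF comb] T by simp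
    then show "\<forall>e\<in>E. c e = 0"
      using indep_familyD[OF independent_imp_indep_family[OF E(1,2)]] by blast
  qed
  moreover have "T e \<in> A" for e unfolding T_def by (rule comb)
  ultimately have "span (T ` E) = A"
    using indep_family_spans(1)[of E T A "\<lambda>e. e"] subspace_A E(4) by auto
  then obtain c where c: "(\<Sum>e\<in>E. scale (counit e) e) = (\<Sum>e\<in>E. scale (c e) (T e))"
    using span_image_family[OF E(1), of "\<Sum>e\<in>E. scale (counit e) e" T] comb by blast
  define M where "M = (\<Sum>e\<in>E. scale (c e) e)"
  have MA: "M \<in> A" unfolding M_def by (rule comb)
  have "(\<Sum>e\<in>E. scale (\<psi> (M * e) - counit e) e) = 0"
    using c T[of c] by (simp add: M_def[symmetric] T_def scale_left_diff_distrib sum_subtractf)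
  then have "\<psi> (M * e) = counit e" if "e \<in> E" for e
    using indep_familyD[OF independent_imp_indep_family[OF E(1,2)], of "\<lambda>e. \<psi> (M * e) - counit e" e] that by simp
  then have M: "\<psi> (M * b) = counit b" if "b \<in> A" for b
    using lf_eq_on_span[of "\<lambda>b. \<psi> (M * b)" counit E b] that E(4)
    by (simp add: lf_comp[OF l] lm_mult_left lm_id counit_lin)
  have "M * a = scale (counit a) M" if a: "a \<in> A" for a
  proof -
    have "\<psi> ((M * a - scale (counit a) M) * b) = 0" if b: "b \<in> A" for b
      using M[OF A_mult[OF a b]] M[OF b]
      by (simp add: left_diff_distrib lf_diff[OF l] mult.assoc scale_mult_left[symmetric] lf_scale[OF l] counit_mult)
    moreover have "M * a - scale (counit a) M \<in> A"
      using a MA by (intro A_diff A_mult A_scale)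
    ultimately show ?thesis using faithful by (auto simp: faithful_on_def)
  qed
  then have "M \<in> R_eps scale counit A" using MA by (simp add: R_eps_def)
  then show ?thesis using M by (rule that)
qed

text \<open>Evaluating \<open>M * L\<close> by both integral properties gives
  \<open>M = \<epsilon>(M) L\<close>, and \<open>\<psi>(M L) = \<epsilon>(L) = 1\<close> excludes
  \<open>\<epsilon>(M) = 0\<close> and \<open>\<psi>(L) = 0\<close>. So \<open>L\<close> inherits
  the right integral property from \<open>M\<close>.\<close>

lemma idempotent_unimodular:
  assumes \<psi>: "cointegral_form A \<psi>" and faithful: "faithful_on A \<psi>" and eps: "counit L = 1"
  shows "\<psi> L \<noteq> 0" "unimodular scale counit A" "L \<in> R_eps scale counit A"
proof -
  have l: "lf \<psi>" using \<psi> by (simp add: cointegral_form_def)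
  obtain M where M: "M \<in> R_eps scale counit A" "\<And>b. b \<in> A \<Longrightarrow> \<psi> (M * b) = counit b"
    using faithful_right_integral[OF assms] by metis
  have MA: "M \<in> A" and Mr: "\<And>a. a \<in> A \<Longrightarrow> M * a = scale (counit a) M"
    using M(1) by (auto simp: R_eps_def)
  have M_eq: "M = scale (counit M) L" using Mr[OF L_in] mult_L[OF MA] eps by simp
  have "counit M * \<psi> L = 1"
    using M(2)[OF L_in] mult_L[OF MA] eps by (simp add: lf_scale[OF l])
  then have nz: "counit M \<noteq> 0" "\<psi> L \<noteq> 0" by auto
  have Lr: "L * a = scale (counit a) L" if a: "a \<in> A" for a
  proof -
    have LM: "L = scale (inverse (counit M)) M" using arg_cong[OF M_eq, of "scale (inverse (counit M))"] nz by simp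
    have "L * a = scale (inverse (counit M)) (M * a)"
      by (subst LM) (simp add: scale_mult_left)
    also have "\<dots> = scale (counit a) L" by (subst LM) (simp add: Mr[OF a] mult.commute)
    finally show ?thesis .
  qed
  show "\<psi> L \<noteq> 0" by (rule nz)
  show LR: "L \<in> R_eps scale counit A" using L_in Lr by (simp add: R_eps_def)
  have mem: "scale c L \<in> L_eps scale counit A" "scale c L \<in> R_eps scale counit A" for c
    using L_in Lr mult_L
    by (auto simp: L_eps_def R_eps_def A_scale scale_mult_left[symmetric] scale_mult_right[symmetric] mult.commute)
  \<comment> \<open>With \<open>L\<close> two-sided and \<open>counit L = 1\<close>, computing
    \<open>L * z\<close> or \<open>z * L\<close> in two ways shows that every integral is a multiple
    of \<open>L\<close>.\<close>
  have "z = scale (counit z) L" if "z \<in> L_eps scale counit A" for z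
    using that L_in Lr[of z] eps by (auto simp: L_eps_def)
  moreover have "z = scale (counit z) L" if "z \<in> R_eps scale counit A" for z
    using that L_in mult_L[of z] eps by (auto simp: R_eps_def)
  ultimately have "L_eps scale counit A = R_eps scale counit A"
    using mem by (metis subsetI subset_antisym)
  then show "unimodular scale counit A" by (simp add: unimodular_def)
qed

lemma subspace_projection:
  assumes "subspace J" obtains p where "lm p" "\<And>z. p z \<in> J" "\<And>z. z \<in> J \<Longrightarrow> p z = z"
proof -
  interpret vector_space_pair scale scale by unfold_locales
  have "Vector_Spaces.linear scale scale (\<lambda>z. z)" by (simp add: linear_iff vector_space_axioms)
  from linear_exists_left_inverse_on[OF this assms] obtain p where
    p: "p ` UNIV \<subseteq> J" "Vector_Spaces.linear scale scale p" "\<forall>z\<in>J. p z = z" by auto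
  then show ?thesis by (intro that[of p]) (auto simp: linear_iff lin_map_def)
qed

text \<open>The element \<open>L\<^sub>2 \<otimes> S\<^sup>-\<^sup>1(L\<^sub>1)\<close> of \<open>A \<otimes> A\<close> is a separability idempotent, so averaging a linear
  projection onto a left ideal over it yields an \<open>A\<close>-linear projection.\<close>

lemma idempotent_semisimple:
  assumes \<psi>: "cointegral_form A \<psi>" and L: "\<psi> L \<noteq> 0" and eps: "counit L = 1"
  shows "semisimple_alg A"
  unfolding semisimple_alg_def
proof (intro allI impI)
  fix K assume K: "left_ideal_in A K"
  have sK: "subspace K"
  proof (rule subspaceI)
    fix c z assume z: "z \<in> K"
    have "scale c 1 * z \<in> K" using K z A_scale[OF A_one] by (auto simp: left_ideal_in_def)
    then show "scale c z \<in> K" by (simp add: scale_mult_left[symmetric])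
  qed (use K in \<open>auto simp: left_ideal_in_def\<close>)
  obtain p where p: "lm p" "\<And>z. p z \<in> K" "\<And>z. z \<in> K \<Longrightarrow> p z = z"
    using subspace_projection[OF sK] by metis
  define q where "q m = (\<Sum>i\<in>I. v i * p (R (x i) * m))" for m
  have lq: "lm q"
    unfolding lin_map_def q_def
    by (simp add: distrib_left lm_add[OF p(1)] lm_scale[OF p(1)] sum.distrib scale_sum_right
        scale_mult_right[symmetric])
  have qK: "q m \<in> K" for m
    using K v_in p(2) unfolding q_def
    by (intro subspace_sum[OF sK]) (auto simp: left_ideal_in_def)
  \<comment> \<open>Multiplying the legs of the averaging element gives
    \<open>\<epsilon>(L) 1\<close>; this is what makes \<open>q\<close> the identity on
    \<open>K\<close>.\<close>
  have unit: "(\<Sum>i\<in>I. v i * R (x i)) = 1"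
  proof (rule lf_eqI)
    fix f assume f: "lf f"
    have "f (\<Sum>i\<in>I. v i * R (x i)) = D (\<lambda>x y. f (y * R x)) L"
      by (subst D_L) (auto intro!: lin_intros lin_R lf_comp[OF f] simp: lf_sum[OF f])
    then show "f (\<Sum>i\<in>I. v i * R (x i)) = f 1" using D_antipode_inverse[OF f, of L] eps by simp
  qed
  have qid: "q m = m" if m: "m \<in> K" for m
  proof -
    have "R (x i) * m \<in> K" if "i \<in> I" for i
      using K m Rx_in[OF \<psi> L that] by (auto simp: left_ideal_in_def)
    then have "q m = (\<Sum>i\<in>I. v i * R (x i)) * m"
      by (simp add: q_def p(3) sum_distrib_right mult.assoc)
    then show ?thesis by (simp add: unit)
  qed
  \<comment> \<open>The exchange rule trades \<open>a\<close> at the right leg for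
    \<open>S a\<close> at the left leg, and \<open>R (S a * x i) = R (x i) * a\<close> hands
    \<open>a\<close> over to the argument of \<open>q\<close>.\<close>
  have qA: "q (a * m) = a * q m" if a: "a \<in> A" for a m
  proof (rule lf_eqI)
    fix f assume f: "lf f"
    note lin = lin_intros lin_R lf_comp[OF f] lm_comp[OF p(1)]
    have "f (a * q m) = (\<Sum>i\<in>I. f (a * v i * p (R (x i) * m)))"
      by (simp add: q_def sum_distrib_left lf_sum[OF f] mult.assoc)
    also have "\<dots> = D (\<lambda>x y. f (a * y * p (R x * m))) L"
      by (rule D_L[symmetric]) (intro lin)
    also have "\<dots> = D (\<lambda>x y. f (y * p (R (S a * x) * m))) L"
      by (rule shift[OF a]) (intro lin)
    also have "\<dots> = (\<Sum>i\<in>I. f (v i * p (R (S a * x i) * m)))"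
      by (rule D_L) (intro lin)
    also have "\<dots> = f (q (a * m))"
      by (simp add: q_def lf_sum[OF f] R_mult R_S mult.assoc)
    finally show "f (q (a * m)) = f (a * q m)" by simp
  qed
  have KA: "K \<subseteq> A" using K by (simp add: left_ideal_in_def)
  define J where "J = {m \<in> A. q m = 0}"
  have "left_ideal_in A J"
    using A_zero A_add A_mult subspace_neg[OF subspace_A] lm_diff[OF lq, of 0]
    by (auto simp: left_ideal_in_def J_def lm_zero[OF lq] lm_add[OF lq] qA)
  moreover have "K \<inter> J = {0}"
    using qid subspace_0[OF sK] A_zero by (auto simp: J_def lm_zero[OF lq])
  moreover have "A = {y + z |y z. y \<in> K \<and> z \<in> J}"
  proof
    show "A \<subseteq> {y + z |y z. y \<in> K \<and> z \<in> J}"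
    proof
      fix m assume m: "m \<in> A"
      have "q m \<in> A" using qK KA by blast
      then have "m - q m \<in> J" using m by (simp add: J_def A_diff lm_diff[OF lq] qid[OF qK])
      then show "m \<in> {y + z |y z. y \<in> K \<and> z \<in> J}"
        using qK[of m] by (intro CollectI exI[of _ "q m"] exI[of _ "m - q m"]) auto
    qed
  qed (use KA A_add in \<open>auto simp: J_def\<close>)
  ultimately show "\<exists>J. left_ideal_in A J \<and> K \<inter> J = {0} \<and> A = {y + z |y z. y \<in> K \<and> z \<in> J}"
    by blast
qed

text \<open>The conditions on right legs come from the two integral properties; those on left legs
  are their mirror images under \<open>S\<close>, which fixes \<open>L\<close>, swaps the legs and
  reverses products.\<close>

lemma idempotent_two_sided_glp:
  assumes r: "L \<in> R_eps scale counit A" and SL: "S L = L" and eps: "counit L = 1"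
  shows "two_sided_glp scale comult L"
proof -
  have LL: "L * L = L" using mult_L[OF L_in] eps by simp
  have right: "(\<Sum>i\<in>I. B (x i) (v i * L)) = B L L" "(\<Sum>i\<in>I. B (x i) (L * v i)) = B L L" if B: "bilin B" for B
  proof -
    have "(\<Sum>i\<in>I. counit (v i) * B (x i) L) = D (\<lambda>x y. counit y * B x L) L"
      by (rule D_L[symmetric]) (intro lin_intros bilin1[OF B] counit_lin)
    also have "\<dots> = B L L" by (rule D_counit_right[OF bilin1[OF B]])
    finally show "(\<Sum>i\<in>I. B (x i) (v i * L)) = B L L" "(\<Sum>i\<in>I. B (x i) (L * v i)) = B L L"
      using r v_in by (simp_all add: R_eps_def mult_L lf_scale[OF bilin2[OF B]])
  qed
  have eqs: "D (\<lambda>x y. B x (y * L)) L = B L L" "D (\<lambda>x y. B x (L * y)) L = B L L"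
    "D (\<lambda>x y. B (x * L) y) L = B L L" "D (\<lambda>x y. B (L * x) y) L = B L L" if B: "bilin B" for B
  proof -
    note lin = lin_intros lf_comp[OF bilin1[OF B]] lf_comp[OF bilin2[OF B]] bilin1[OF B] bilin2[OF B]
    have B': "bilin (\<lambda>x y. B (S y) (S x))" by (intro lin)
    show "D (\<lambda>x y. B x (y * L)) L = B L L"
      by (subst D_L, intro lin) (rule right(1)[OF B])
    show "D (\<lambda>x y. B x (L * y)) L = B L L"
      by (subst D_L, intro lin) (rule right(2)[OF B])
    have "D (\<lambda>x y. B (x * L) y) L = (\<Sum>i\<in>I. B (S (v i) * L) (S (x i)))"
      by (rule tensor_repD[OF antipode_rep[OF SL]]) (intro lin)
    then show "D (\<lambda>x y. B (x * L) y) L = B L L"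
      using right(2)[OF B'] SL by (simp add: antipode_mult)
    have "D (\<lambda>x y. B (L * x) y) L = (\<Sum>i\<in>I. B (L * S (v i)) (S (x i)))"
      by (rule tensor_repD[OF antipode_rep[OF SL]]) (intro lin)
    then show "D (\<lambda>x y. B (L * x) y) L = B L L"
      using right(1)[OF B'] SL by (simp add: antipode_mult)
  qed
  have map: "(\<Sum>(x, y)\<leftarrow>map (\<lambda>(x, y). (F x y, G x y)) (comult L). B x y) = D (\<lambda>x y. B (F x y) (G x y)) L" for F G B
    by (simp add: D_def case_prod_beta' o_def)
  show ?thesis
    unfolding two_sided_glp_def
    by (intro conjI nonzero LL teqI; simp only: map; simp add: eqs)
qed

end

section \<open>Semisimple coideal subalgebras\<close>

context hopf_algebra
begin

text \<open>\<open>L\<close> is the component of \<open>1\<close> in a complement \<open>J\<close>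
  of the augmentation ideal \<open>K\<close>, so \<open>z * L\<close> lies in
  \<open>K \<inter> J\<close> for \<open>z\<close> in \<open>K\<close>, and \<open>L\<close> is a
  left integral. The obstruction \<open>N = L K\<close> to the right integral property vanishes by a
  second use of semisimplicity.\<close>

lemma semisimple_integral:
  assumes A: "subalg scale A" and ss: "semisimple_alg A"
  obtains L where "L \<in> L_eps scale counit A" "L \<in> R_eps scale counit A" "counit L = 1"
proof -
  note sA = subalg_subspace[OF A]
  have A1: "1 \<in> A" and Am: "\<And>a b. a \<in> A \<Longrightarrow> b \<in> A \<Longrightarrow> a * b \<in> A" using A by (auto simp: subalg_def)
  define K where "K = {a \<in> A. counit a = 0}"
  note e = lf_add[OF counit_lin] lf_zero[OF counit_lin] lf_minus[OF counit_lin] lf_diff[OF counit_lin]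
    lf_scale[OF counit_lin] counit_mult counit_one
  note A_cl = subspace_0[OF sA] subspace_add[OF sA] subspace_neg[OF sA] subspace_diff[OF sA] subspace_scale[OF sA] Am A1
  have "left_ideal_in A K" by (auto simp: left_ideal_in_def K_def e A_cl)
  then obtain J where J: "left_ideal_in A J" "K \<inter> J = {0}" "A = {y + z |y z. y \<in> K \<and> z \<in> J}"
    using ss[unfolded semisimple_alg_def] by (elim allE impE exE conjE)
  obtain u L where u: "1 = u + L" "u \<in> K" "L \<in> J" using A1 by (subst (asm) J(3)) blast
  have LA: "L \<in> A" using u(3) J(1) by (auto simp: left_ideal_in_def)
  have eL: "counit L = 1" using arg_cong[OF u(1), of counit] u(2) by (simp add: e K_def)
  have KL: "z * L = 0" if "z \<in> K" for z
  proof -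
    have "z * L \<in> K" using that LA by (auto simp: K_def e Am)
    moreover have "z * L \<in> J" using that J(1) u(3) by (auto simp: K_def left_ideal_in_def)
    ultimately show ?thesis using J(2) by blast
  qed
  have aug: "a - scale (counit a) 1 \<in> K" if "a \<in> A" for a using that by (auto simp: K_def e A_cl)
  have left: "a * L = scale (counit a) L" if "a \<in> A" for a
    using KL[OF aug[OF that]] by (simp add: left_diff_distrib scale_mult_left[symmetric])
  define N where "N = (\<lambda>z. L * z) ` K"
  have "left_ideal_in A N"
    unfolding left_ideal_in_def
  proof (intro conjI ballI)
    show "N \<subseteq> A" by (auto simp: N_def K_def Am LA)
    have "0 \<in> K" by (simp add: K_def e A_cl)
    then have "L * 0 \<in> N" unfolding N_def by (rule imageI)
    then show "0 \<in> N" by simp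
  next
    fix y z assume "y \<in> N" "z \<in> N"
    then obtain y' z' where yz: "y = L * y'" "z = L * z'" "y' \<in> K" "z' \<in> K" by (auto simp: N_def)
    then have "y + z = L * (y' + z')" "y' + z' \<in> K" by (auto simp: distrib_left K_def e A_cl)
    then show "y + z \<in> N" by (auto simp: N_def)
  next
    fix y assume "y \<in> N"
    then obtain y' where y: "y = L * y'" "y' \<in> K" by (auto simp: N_def)
    then have "- y = L * (- y')" "- y' \<in> K" by (auto simp: K_def e A_cl)
    then show "- y \<in> N" unfolding N_def by (rule image_eqI)
  next
    fix a y assume a: "a \<in> A" and "y \<in> N"
    then obtain y' where y: "y = L * y'" "y' \<in> K" by (auto simp: N_def)
    have "a * y = (a * L) * y'" by (simp add: y mult.assoc)
    also have "\<dots> = L * scale (counit a) y'"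
      by (simp add: left[OF a] scale_mult_left[symmetric] scale_mult_right[symmetric])
    finally have "a * y = L * scale (counit a) y'" .
    moreover have "scale (counit a) y' \<in> K" using y(2) by (auto simp: K_def e A_cl)
    ultimately show "a * y \<in> N" unfolding N_def by (rule image_eqI)
  qed
  then obtain P where P: "left_ideal_in A P" "N \<inter> P = {0}" "A = {y + z |y z. y \<in> N \<and> z \<in> P}"
    using ss[unfolded semisimple_alg_def] by (elim allE impE exE conjE)
  obtain n k where nk: "1 = n + k" "n \<in> N" "k \<in> P" using A1 by (subst (asm) P(3)) blast
  \<comment> \<open>\<open>N\<close> is a two-sided ideal with \<open>N\<^sup>2 = 0\<close>, hence zero.\<close>
  have LK: "L * z = 0" if z: "z \<in> K" for z
  proof -
    have kA: "k \<in> A" using nk(3) P(1) by (auto simp: left_ideal_in_def)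
    obtain w where w: "n = L * w" using nk(2) by (auto simp: N_def)
    have "L * z * n = L * (z * L) * w" by (simp add: w mult.assoc)
    then have 1: "L * z * n = 0" using KL[OF z] by simp
    have "z * k \<in> K" using z kA by (auto simp: K_def e Am)
    then have "L * z * k \<in> N" unfolding N_def mult.assoc by (rule imageI)
    moreover have "L * z * k \<in> P" using z LA nk(3) P(1) by (auto simp: left_ideal_in_def K_def Am)
    ultimately have 2: "L * z * k = 0" using P(2) by blast
    have "L * z = L * z * (n + k)" by (simp add: nk(1)[symmetric])
    then show ?thesis using 1 2 by (simp add: distrib_left)
  qed
  have "L * a = scale (counit a) L" if "a \<in> A" for a
    using LK[OF aug[OF that]] by (simp add: right_diff_distrib scale_mult_right[symmetric])
  then show ?thesis using left LA eL by (intro that[of L]) (auto simp: L_eps_def R_eps_def)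
qed

text \<open>The cointegral is the trace of \<open>x \<mapsto> a S\<^sup>2(x)\<close>; this works because the matrix coefficients \<open>m\<close> of the
  coaction on a basis satisfy \<open>m S(m) = 1\<close>.\<close>

lemma trace_cointegral:
  assumes A: "left_coideal_subalg scale comult A" and SSA: "\<And>a. a \<in> A \<Longrightarrow> S (S a) \<in> A"
    and E: "finite E" "E \<subseteq> A" "span E = A"
    and f: "\<And>b. lf (f b)" "\<And>b c. b \<in> E \<Longrightarrow> c \<in> E \<Longrightarrow> f b c = (if b = c then 1 else 0)"
  shows "cointegral_form A (\<lambda>a. \<Sum>b\<in>E. f b (a * S (S b)))"
proof -
  have EA: "b \<in> A" if "b \<in> E" for b using that E by auto
  have Am: "\<And>a b. a \<in> A \<Longrightarrow> b \<in> A \<Longrightarrow> a * b \<in> A" using A by (auto simp: left_coideal_subalg_def subalg_def)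
  have expand: "g y = (\<Sum>c\<in>E. f c y * g c)" if "lf g" "y \<in> A" for g y
    by (rule lf_expand[OF that(1)], rule dual_family_expand[OF E(1) f(1), where x = "\<lambda>b. b"])
       (use f(2) that(2) E(3) in auto)
  \<comment> \<open>Matrix coefficients of the coaction: \<open>\<Delta>(b)\<close> is the sum of
    \<open>m b c \<otimes> c\<close> over \<open>c\<close> in the basis. \<open>M1\<close> is this
    expansion; \<open>M2\<close> and \<open>M3\<close> give the coproduct and counit of the
    coefficients.\<close>
  define m where "m b c = (\<Sum>(p, q)\<leftarrow>comult b. scale (f c q) p)" for b c
  have m: "g (m b c) = D (\<lambda>p q. f c q * g p) b" if "lf g" for g b c
    by (simp add: m_def lf_sum_list[OF that] lf_scale[OF that] D_def)
  have M1: "D B b = (\<Sum>c\<in>E. B (m b c) c)" if B: "bilin B" and b: "b \<in> E" for B b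
  proof -
    obtain t where t: "teq scale t (comult b)" "\<forall>(x, y)\<in>set t. y \<in> A"
      using A EA[OF b] by (auto simp: left_coideal_subalg_def)
    have "D B b = (\<Sum>(p, q)\<leftarrow>t. B p q)" by (rule teq_comult_D[OF t(1) B, symmetric])
    also have "\<dots> = (\<Sum>(p, q)\<leftarrow>t. \<Sum>c\<in>E. f c q * B p c)"
      using t(2) by (intro sum_list_pair_cong expand bilin2[OF B]) auto
    also have "\<dots> = (\<Sum>c\<in>E. \<Sum>(p, q)\<leftarrow>t. f c q * B p c)" by (rule sum_list_sum_swap)
    also have "\<dots> = (\<Sum>c\<in>E. D (\<lambda>p q. f c q * B p c) b)"
      by (intro sum.cong refl teq_comult_D[OF t(1)] bilin_prod' bilin1[OF B] f(1))
    also have "\<dots> = (\<Sum>c\<in>E. B (m b c) c)"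
      by (intro sum.cong refl m[symmetric] bilin1[OF B])
    finally show ?thesis .
  qed
  have M2: "D B (m b c) = (\<Sum>d\<in>E. B (m b d) (m d c))" if B: "bilin B" and b: "b \<in> E" for B b c
  proof -
    note lin = lin_intros lin_D bilin1[OF B] bilin2[OF B] f(1)
    have "D B (m b c) = D (\<lambda>x y. D (\<lambda>u w. f c y * B u w) x) b"
      by (simp add: m[OF lf_D[OF B]] D_mult_const)
    also have "\<dots> = D (\<lambda>x y. D (\<lambda>u w. f c w * B x u) y) b"
      by (rule D_coassoc; intro lin)
    also have "\<dots> = (\<Sum>d\<in>E. D (\<lambda>u w. f c w * B (m b d) u) d)"
      by (rule M1[OF _ b]) (intro lin)
    also have "\<dots> = (\<Sum>d\<in>E. B (m b d) (m d c))"
      by (intro sum.cong refl m[symmetric] bilin2[OF B])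
    finally show ?thesis .
  qed
  have M3: "counit (m b c) = (if b = c then 1 else 0)" if "b \<in> E" "c \<in> E" for b c
    using m[OF counit_lin, of b c] D_counit_left[OF f(1), of c b] f(2) that by (simp add: mult.commute)
  have M4: "(\<Sum>d\<in>E. m b d * S (m d c)) = (if b = c then 1 else 0)" if bc: "b \<in> E" "c \<in> E" for b c
  proof (rule lf_eqI)
    fix g assume g: "lf g"
    have "g (\<Sum>d\<in>E. m b d * S (m d c)) = D (\<lambda>x y. g (x * S y)) (m b c)"
      by (subst M2[OF _ bc(1)]) (auto intro!: lin_intros lf_comp[OF g] simp: lf_sum[OF g])
    then show "g (\<Sum>d\<in>E. m b d * S (m d c)) = g (if b = c then 1 else 0)"
      by (simp add: D_antipode_right[OF g] M3[OF bc] lf_zero[OF g])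
  qed
  \<comment> \<open>\<open>S\<close> reverses the products in \<open>M4\<close>; this form matches
    the coefficients of the squared antipode.\<close>
  have M5: "(\<Sum>d\<in>E. S (S (m d c)) * S (m b d)) = (if b = c then 1 else 0)" if bc: "b \<in> E" "c \<in> E" for b c
    using arg_cong[OF M4[OF bc], of S]
    by (simp add: lm_sum[OF antipode_lin] antipode_mult antipode_one lm_zero[OF antipode_lin] split: if_splits)
  define \<phi> where "\<phi> a = (\<Sum>b\<in>E. f b (a * S (S b)))" for a
  have l: "lf \<phi>" unfolding \<phi>_def by (intro lf_sum_fun lf_comp[OF f(1)] lin_intros)
  have "D (\<lambda>x y. \<phi> y * g x) a = \<phi> a * g 1" if a: "a \<in> A" and g: "lf g" for a g
  proof -
    note lin = lin_intros lin_D lf_comp[OF g] lf_comp[OF f(1)] f(1) g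
    \<comment> \<open>Computed in two ways. Expanding \<open>a * S (S j)\<close> in \<open>E\<close>
      and summing over \<open>i\<close> first, \<open>M4\<close> leaves
      \<open>\<phi>(a) g(1)\<close>. Expanding the coproduct of the product and summing over
      \<open>j\<close> first, \<open>M5\<close> leaves
      \<open>\<phi>(a\<^sub>2) g(a\<^sub>1)\<close>.\<close>
    let ?T = "\<Sum>j\<in>E. \<Sum>i\<in>E. D (\<lambda>x y. g (x * S (m i j)) * f i y) (a * S (S j))"
    have "(\<Sum>i\<in>E. D (\<lambda>x y. g (x * S (m i j)) * f i y) (a * S (S j))) = f j (a * S (S j)) * g 1" if j: "j \<in> E" for j
    proof -
      have aj: "a * S (S j) \<in> A" by (intro Am a SSA EA j)
      let ?c = "\<lambda>k. f k (a * S (S j))"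
      have "D (\<lambda>x y. g (x * S (m i j)) * f i y) (a * S (S j)) = (\<Sum>k\<in>E. ?c k * g (m k i * S (m i j)))"
        if i: "i \<in> E" for i
      proof -
        have B: "bilin (\<lambda>x y. g (x * S (m i j)) * f i y)" by (intro lin)
        have "D (\<lambda>x y. g (x * S (m i j)) * f i y) k = g (m k i * S (m i j))" if k: "k \<in> E" for k
          using M1[OF B k] i E(1) by (simp add: f(2) if_distrib[of "\<lambda>z. _ * z"] cong: if_cong)
        then show ?thesis using expand[OF lf_D[OF B] aj] by simp
      qed
      then have "(\<Sum>i\<in>E. D (\<lambda>x y. g (x * S (m i j)) * f i y) (a * S (S j)))
          = (\<Sum>i\<in>E. \<Sum>k\<in>E. ?c k * g (m k i * S (m i j)))" by simp
      also have "\<dots> = (\<Sum>k\<in>E. ?c k * g (\<Sum>i\<in>E. m k i * S (m i j)))"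
        by (subst sum.swap) (simp add: lf_sum[OF g] sum_distrib_left)
      also have "\<dots> = (\<Sum>k\<in>E. if k = j then ?c k * g 1 else 0)"
        using j by (intro sum.cong refl) (auto simp: M4 lf_zero[OF g])
      finally show ?thesis using j E(1) by simp
    qed
    then have 1: "?T = \<phi> a * g 1" by (simp add: \<phi>_def sum_distrib_right)
    have "(\<Sum>j\<in>E. D (\<lambda>x y. g (x * S (m i j)) * f i y) (a * S (S j))) = D (\<lambda>x y. f i (y * S (S i)) * g x) a"
      if i: "i \<in> E" for i
    proof -
      have "D (\<lambda>x y. g (x * S (m i j)) * f i y) (a * S (S j))
          = (\<Sum>l\<in>E. D (\<lambda>x y. g (x * (S (S (m j l)) * S (m i j))) * f i (y * S (S l))) a)" if j: "j \<in> E" for j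
      proof -
        \<comment> \<open>Two swaps of the legs cancel, so the squared antipode respects the
          coproduct.\<close>
        have SS: "D B (S (S j)) = (\<Sum>l\<in>E. B (S (S (m j l))) (S (S l)))" if B: "bilin B" for B
        proof -
          note lB = lin_intros lf_comp[OF bilin1[OF B]] lf_comp[OF bilin2[OF B]]
          have "D B (S (S j)) = D (\<lambda>x y. B (S y) (S x)) (S j)" by (rule antipode_comult[OF B])
          also have "\<dots> = D (\<lambda>x y. B (S (S x)) (S (S y))) j" by (rule antipode_comult) (intro lB)
          also have "\<dots> = (\<Sum>l\<in>E. B (S (S (m j l))) (S (S l)))" by (rule M1[OF _ j]) (intro lB)
          finally show ?thesis .
        qed
        have "D (\<lambda>x y. g (x * S (m i j)) * f i y) (a * S (S j))
          = D (\<lambda>x y. D (\<lambda>x' y'. g (x * x' * S (m i j)) * f i (y * y')) (S (S j))) a"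
          by (rule D_mult) (intro lin)
        also have "\<dots> = D (\<lambda>x y. \<Sum>l\<in>E. g (x * S (S (m j l)) * S (m i j)) * f i (y * S (S l))) a"
          by (intro D_cong SS lin)
        finally show ?thesis by (simp add: D_sum mult.assoc)
      qed
      then have "(\<Sum>j\<in>E. D (\<lambda>x y. g (x * S (m i j)) * f i y) (a * S (S j)))
        = (\<Sum>j\<in>E. \<Sum>l\<in>E. D (\<lambda>x y. g (x * (S (S (m j l)) * S (m i j))) * f i (y * S (S l))) a)" by simp
      also have "\<dots> = (\<Sum>l\<in>E. \<Sum>j\<in>E. D (\<lambda>x y. g (x * (S (S (m j l)) * S (m i j))) * f i (y * S (S l))) a)"
        by (rule sum.swap)
      also have "\<dots> = (\<Sum>l\<in>E. D (\<lambda>x y. g (x * (\<Sum>j\<in>E. S (S (m j l)) * S (m i j))) * f i (y * S (S l))) a)"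
        by (simp add: D_sum[symmetric] sum_distrib_left sum_distrib_right lf_sum[OF g])
      also have "\<dots> = (\<Sum>l\<in>E. if i = l then D (\<lambda>x y. f i (y * S (S i)) * g x) a else 0)"
      proof (intro sum.cong refl)
        fix l assume "l \<in> E"
        then show "D (\<lambda>x y. g (x * (\<Sum>j\<in>E. S (S (m j l)) * S (m i j))) * f i (y * S (S l))) a
          = (if i = l then D (\<lambda>x y. f i (y * S (S i)) * g x) a else 0)"
          by (simp add: M5[OF i] lf_zero[OF g] mult.commute[of "g _"]) (simp add: D_def case_prod_beta')
      qed
      finally show ?thesis using i E(1) by simp
    qed
    then have "(\<Sum>i\<in>E. \<Sum>j\<in>E. D (\<lambda>x y. g (x * S (m i j)) * f i y) (a * S (S j)))
        = D (\<lambda>x y. \<phi> y * g x) a"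
      by (simp add: \<phi>_def sum_distrib_right D_sum)
    then show ?thesis using 1 by (subst (asm) sum.swap) simp
  qed
  then have "cointegral_form A \<phi>" using l by (simp add: cointegral_form_def)
  then show ?thesis by (simp add: \<phi>_def[abs_def])
qed

end

section \<open>Assembly of the three claims\<close>

lemma coideal_integral_exists:
  assumes "hopf_algebra scale comult counit S" "left_coideal_subalg scale comult A"
    "L \<in> L_eps scale counit A" "L \<noteq> 0"
  obtains I x v where "coideal_integral scale comult counit S A L I x v"
proof -
  interpret hopf_algebra scale comult counit S by fact
  obtain I x v where "tensor_rep I x v L" "indep_family I x" "indep_family I v"
    using minimal_tensor_rep .
  with assms have "coideal_integral scale comult counit S A L I x v"
    by (simp add: coideal_integral_def coideal_integral_axioms_def)
  then show ?thesis by (rule that)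
qed

context hopf_algebra
begin

lemma A_of_integral:
  assumes "integral_type scale comult L"
  shows "left_coideal_subalg scale comult (A_of scale comult L)" "L \<in> L_eps scale counit (A_of scale comult L)" "L \<noteq> 0"
  using assms absorbing_coideal[of L] absorbs_counit[of L]
  by (auto simp: A_of_eq L_eps_def integral_type_absorbs)

lemma unimodular_antipode:
  assumes L: "integral_type scale comult L"
    and uni: "unimodular scale counit (A_of scale comult L)"
    and \<phi>: "faithful_one_cointegral scale comult (A_of scale comult L) \<phi>"
  shows "S L = L" "(S \<circ> S) ` (A_of scale comult L) = A_of scale comult L"
proof -
  let ?A = "A_of scale comult L"
  note LA = A_of_integral[OF L]
  obtain I x v where "coideal_integral scale comult counit S ?A L I x v"
    using coideal_integral_exists[OF hopf_algebra_axioms LA] .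
  then interpret coideal_integral scale comult counit S ?A L I x v .
  have "one_cointegral scale comult ?A \<phi>" using \<phi> by (simp add: faithful_one_cointegral_def)
  then obtain \<psi> where \<psi>: "cointegral_form ?A \<psi>" "\<And>a. a \<in> ?A \<Longrightarrow> \<psi> a = \<phi> a"
    using one_cointegral_extend[OF coideal] by metis
  have l: "lf \<psi>" using \<psi> by (simp add: cointegral_form_def)
  have r: "L \<in> R_eps scale counit ?A" using integral uni by (simp add: unimodular_def)
  \<comment> \<open>By the right integral property
    \<open>\<psi> (L * b) = counit b * \<psi> L\<close>, so \<open>\<psi> L = 0\<close> would
    contradict faithfulness at \<open>L\<close>.\<close>
  have nz: "\<psi> L \<noteq> 0"
  proof
    assume "\<psi> L = 0"
    then have "\<phi> (L * b) = 0" if "b \<in> ?A" for b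
      using r that \<psi>(2)[OF A_mult[OF L_in that]] by (auto simp: R_eps_def lf_scale[OF l])
    then show False using \<phi> L_in nonzero by (auto simp: faithful_one_cointegral_def faithful_on_def)
  qed
  show SL: "S L = L" by (rule antipode_integral[OF \<psi>(1) nz r])
  show "(S \<circ> S) ` ?A = ?A" by (rule antipode_square_A[OF \<psi>(1) nz SL])
qed

lemma idempotent_integral_type:
  assumes L: "integral_type scale comult L" and LL: "L * L = L"
    and \<phi>: "faithful_one_cointegral scale comult (A_of scale comult L) \<phi>"
  shows "unimodular scale counit (A_of scale comult L)" "two_sided_glp scale comult L"
    "semisimple_alg (A_of scale comult L)"
proof -
  let ?A = "A_of scale comult L"
  note LA = A_of_integral[OF L]
  obtain I x v where "coideal_integral scale comult counit S ?A L I x v"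
    using coideal_integral_exists[OF hopf_algebra_axioms LA] .
  then interpret coideal_integral scale comult counit S ?A L I x v .
  have "one_cointegral scale comult ?A \<phi>" using \<phi> by (simp add: faithful_one_cointegral_def)
  then obtain \<psi> where \<psi>: "cointegral_form ?A \<psi>" "\<And>a. a \<in> ?A \<Longrightarrow> \<psi> a = \<phi> a"
    using one_cointegral_extend[OF coideal] by metis
  have faithful: "faithful_on ?A \<psi>"
    using \<phi> A_mult \<psi>(2) by (simp add: faithful_one_cointegral_def faithful_on_def)
  \<comment> \<open>The left integral property gives \<open>L * L = \<epsilon>(L) L\<close>;
    idempotency of the nonzero \<open>L\<close> then fixes the counit.\<close>
  have "scale (counit L) L = scale 1 L" using mult_L[OF L_in] LL by simp
  then have eps: "counit L = 1" using nonzero scale_right_imp_eq by blast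
  note u = idempotent_unimodular[OF \<psi>(1) faithful eps]
  show "unimodular scale counit ?A" by (rule u(2))
  show "two_sided_glp scale comult L"
    by (rule idempotent_two_sided_glp[OF u(3) antipode_integral[OF \<psi>(1) u(1,3)] eps])
  show "semisimple_alg ?A" by (rule idempotent_semisimple[OF \<psi>(1) u(1) eps])
qed

text \<open>The nonzero value of the trace cointegral at the integral gives faithfulness by
  \<open>cointegral_faithful\<close> and uniqueness by \<open>cointegral_unique\<close>.\<close>

lemma semisimple_cointegral:
  assumes A: "left_coideal_subalg scale comult A" and ss: "semisimple_alg A" and SS: "(S \<circ> S) ` A = A"
  obtains \<phi> where "faithful_one_cointegral scale comult A \<phi>"
    "\<And>\<psi>. one_cointegral scale comult A \<psi> \<Longrightarrow> \<exists>c. \<forall>a\<in>A. \<psi> a = c * \<phi> a"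
proof -
  obtain L where L: "L \<in> L_eps scale counit A" "L \<in> R_eps scale counit A" "counit L = 1"
    using semisimple_integral[OF _ ss] A by (auto simp: left_coideal_subalg_def)
  have nz: "L \<noteq> 0" using L(3) lf_zero[OF counit_lin] by auto
  obtain I x v where "coideal_integral scale comult counit S A L I x v"
    using coideal_integral_exists[OF hopf_algebra_axioms A L(1) nz] .
  then interpret coideal_integral scale comult counit S A L I x v .
  obtain E where E: "finite E" "independent E" "E \<subseteq> A" "span E = A" using finite_basis[OF L(3)] .
  obtain f where f: "\<And>b. lf (f b)" "\<And>b c. b \<in> E \<Longrightarrow> c \<in> E \<Longrightarrow> f b c = (if b = c then 1 else 0)"
    using dual_family[OF independent_imp_indep_family[OF E(1,2)]] by metis
  have SSA: "S (S a) \<in> A" if "a \<in> A" for a using that SS by auto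
  define \<phi> where "\<phi> a = (\<Sum>b\<in>E. f b (a * S (S b)))" for a
  have \<phi>: "cointegral_form A \<phi>"
    unfolding \<phi>_def[abs_def] by (rule trace_cointegral[OF A SSA E(1,3,4) f])
  \<comment> \<open>\<open>L\<close> is a right integral and \<open>S\<close> preserves the counit,
    so the trace reduces to the basis expansion of \<open>counit L\<close>, which is 1.\<close>
  have "\<phi> L = (\<Sum>b\<in>E. f b L * counit b)"
    using L(2) SSA E(3) unfolding \<phi>_def
    by (intro sum.cong) (auto simp: R_eps_def lf_scale[OF f(1)] counit_antipode)
  also have "\<dots> = counit L"
    by (rule lf_expand[OF counit_lin, symmetric], rule dual_family_expand[OF E(1) f(1), where x = "\<lambda>b. b"])
       (use f(2) E(4) L_in in auto)
  finally have \<phi>L: "\<phi> L \<noteq> 0" by (simp add: L(3))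
  show ?thesis
  proof (rule that[of \<phi>])
    show "faithful_one_cointegral scale comult A \<phi>"
      using cointegral_form_one_cointegral[OF \<phi>] cointegral_faithful[OF \<phi> \<phi>L]
      by (simp add: faithful_one_cointegral_def)
    fix \<psi> assume "one_cointegral scale comult A \<psi>"
    then obtain \<chi> where \<chi>: "cointegral_form A \<chi>" "\<And>a. a \<in> A \<Longrightarrow> \<chi> a = \<psi> a"
      using one_cointegral_extend[OF A] by metis
    then have "\<forall>a\<in>A. \<psi> a = \<chi> L / \<phi> L * \<phi> a"
      using cointegral_unique[OF \<phi> \<phi>L \<chi>(1)] by metis
    then show "\<exists>c. \<forall>a\<in>A. \<psi> a = c * \<phi> a" ..
  qed
qed

end

theorem mainTheorem17:
  fixes scale :: "'k::field \<Rightarrow> 'h::ring_1 \<Rightarrow> 'h"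
    and comult :: "'h \<Rightarrow> ('h \<times> 'h) list"
    and counit :: "'h \<Rightarrow> 'k"
    and S :: "'h \<Rightarrow> 'h"
    and L :: 'h
  assumes H: "hopf_algebra scale comult counit S"
    and L: "integral_type scale comult L"
  shows
   "(unimodular scale counit (A_of scale comult L) \<and>
       (\<exists>phi. faithful_one_cointegral scale comult (A_of scale comult L) phi)
     \<longrightarrow> S L = L \<and> (S \<circ> S) ` (A_of scale comult L) = A_of scale comult L)
  \<and> (L * L = L \<and> (\<exists>phi. faithful_one_cointegral scale comult (A_of scale comult L) phi)
     \<longrightarrow> unimodular scale counit (A_of scale comult L)
       \<and> (S \<circ> S) ` (A_of scale comult L) = A_of scale comult L
       \<and> two_sided_glp scale comult L
       \<and> semisimple_alg (A_of scale comult L))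
  \<and> (\<forall>A. left_coideal_subalg scale comult A \<and> semisimple_alg A \<and> (S \<circ> S) ` A = A
     \<longrightarrow> (\<exists>phi. faithful_one_cointegral scale comult A phi \<and>
            (\<forall>psi. one_cointegral scale comult A psi \<longrightarrow>
               (\<exists>c. \<forall>a\<in>A. psi a = c * phi a))))"
proof -
  interpret hopf_algebra scale comult counit S by (rule H)
  \<comment> \<open>The assertion on \<open>S \<circ> S\<close> in the second claim comes from the
    first, once unimodularity is known.\<close>
  show ?thesis
    using unimodular_antipode[OF L] idempotent_integral_type[OF L] semisimple_cointegral by metis
qed

end
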